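(* The topologies induced by $d_\tau$ and $d_{\mathrm{conc}}$ coincide on the subspace of mm-spaces in $\mathcal D$. Equivalently, for mm-spaces $X$ and $X_n$ ($n\in\mathbb N$), \[d_\tau(X_n,X)\longrightarrow0\quad\Longleftrightarrow\quad d_{\mathrm{conc}}(X_n,X)\longrightarrow0\qquad(n\to\infty).\]
   Context: A geometric data set is a triple $(X,F_X,\mu_X)$ where $F_X$ is a nonempty family of real-valued functions (features) on $X$ such that $d_X(x,x'):=\sup_{f\in F_X}|f(x)-f(x')|$ is a (finite) complete separable metric on $X$, and $\mu_X$ is a Borel probability measure on $(X,d_X)$ with full support. $\overline{F_X}$ denotes the closure of $F_X$ in the set of real-valued functions on $X$ under pointwise convergence. $X$ and $Y$ are isomorphic if there is a Borel map $\phi:X\to Y$ with $\phi_*\mu_X=\mu_Y$ and $\overline{F_Y}\circ\phi=\overline{F_X}$. Isomorphic geometric data sets are identified; $\mathcal D$ is the set of isomorphism classes. $\mathcal T(\mu,\nu)$ is the set of couplings of $\mu,\nu$ (Borel probability measures on the product with marginals $\mu,\nu$); $\mathrm{pr}_1,\mathrm{pr}_2$ are the coordinate projections; $(d)_H$ is the Hausdorff distance induced by $d$. mm-spaces. An mm-space is a triple $(X,d_X,\mu_X)$ with $(X,d_X)$ a complete separable metric space and $\mu_X$ a Borel probability measure with full support. It is regarded as the geometric data set $(X,\operatorname{Lip}_1(X,d_X),\mu_X)$, where $\operatorname{Lip}_1(X,d_X)$ is the family of all real-valued $1$-Lipschitz functions on $(X,d_X)$. Compactified observable distance. $\tau:\mathbb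 R\to(-1/2,1/2)$, $\tau(r)=\frac12\tanh r$. $\mathsf K_\tau(X)$ is the closure of $\{\tau\circ f\mid f\in F_X\}$ under pointwise convergence on $X$. With $d_{1,\pi}(u,v)=\int|u-v|\,d\pi$, set $D_\tau^\pi(X,Y):=(d_{1,\pi})_H(\mathsf K_\tau(X)\circ\mathrm{pr}_1,\mathsf K_\tau(Y)\circ\mathrm{pr}_2)$ for $\pi\in\mathcal T(\mu_X,\mu_Y)$ and $d_\tau(X,Y):=\inf_{\pi\in\mathcal T(\mu_X,\mu_Y)}D^\pi_\tau(X,Y)$; this is a metric on $\mathcal D$. Observable distance. The Ky Fan metric on a probability space $(Z,\xi)$ is $d_{\mathrm{KF}}^\xi(u,v):=\inf\{\epsilon\ge0\mid\xi(\{|u-v|>\epsilon\})\le\epsilon\}$. A parameter of $\mu_X$ is a Borel map $\varphi:[0,1)\to X$ with $\varphi_*\lambda=\mu_X$, $\lambda$ being Lebesgue measure on $[0,1)$. Then $d_{\mathrm{conc}}(X,Y):=\inf_{\varphi,\psi}(d_{\mathrm{KF}}^\lambda)_H(F_X\circ\varphi,F_Y\circ\psi)$, where $\varphi,\psi$ range over the parameters of $\mu_X,\mu_Y$; this is a metric on $\mathcal D$. *)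

theory Defs
  imports "HOL-Probability.Probability"
begin

definition borel_of :: "'a topology \<Rightarrow> 'a measure" where
  "borel_of T = sigma (topspace T) {U. openin T U}"

text \<open>Real-valued functions on a set \<open>S\<close> are the elements of \<open>extensional S\<close>, which is the
  underlying set of \<open>powertop_real S\<close>, the topology of pointwise convergence. Accordingly
  all compositions are taken with \<open>compose\<close>, which restricts to the domain.\<close>

subsection \<open>Geometric data sets\<close>

record 'a gds =
  pts :: "'a set"
  feats :: "('a \<Rightarrow> real) set"
  gmeas :: "'a measure"

text \<open>The guard makes the function total with value \<open>0\<close> off the carrier, as \<open>Metric_space\<close>
  demands symmetry and nonnegativity on the whole type.\<close>

definition feat_dist :: "'a gds \<Rightarrow> 'a \<Rightarrow> 'a \<Rightarrow> real" where
  "feat_dist X x x' =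
     (if x \<in> pts X \<and> x' \<in> pts X then (SUP f\<in>feats X. \<bar>f x - f x'\<bar>) else 0)"

definition gds_topology :: "'a gds \<Rightarrow> 'a topology" where
  "gds_topology X = Metric_space.mtopology (pts X) (feat_dist X)"

definition geometric_data_set :: "'a gds \<Rightarrow> bool" where
  "geometric_data_set X \<longleftrightarrow>
     feats X \<noteq> {} \<and> feats X \<subseteq> extensional (pts X) \<and>
     (\<forall>x\<in>pts X. \<forall>x'\<in>pts X. bdd_above ((\<lambda>f. \<bar>f x - f x'\<bar>) ` feats X)) \<and>
     Metric_space (pts X) (feat_dist X) \<and>
     Metric_space.mcomplete (pts X) (feat_dist X) \<and>
     separable_space (gds_topology X) \<and>
     prob_space (gmeas X) \<and> space (gmeas X) = pts X \<and>
     sets (gmeas X) = sets (borel_of (gds_topology X)) \<and>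
     (\<forall>U. openin (gds_topology X) U \<and> U \<noteq> {} \<longrightarrow> measure (gmeas X) U > 0)"

definition gds_isomorphic :: "'a gds \<Rightarrow> 'b gds \<Rightarrow> bool" where
  "gds_isomorphic X Y \<longleftrightarrow>
     (\<exists>\<phi>. \<phi> \<in> gmeas X \<rightarrow>\<^sub>M gmeas Y \<and> distr (gmeas X) (gmeas Y) \<phi> = gmeas Y \<and>
        (\<lambda>f. compose (pts X) f \<phi>) ` (powertop_real (pts Y) closure_of feats Y)
          = powertop_real (pts X) closure_of feats X)"

text \<open>The set of isomorphism classes of geometric data sets carried by subsets of \<open>'a\<close>.
  A complete separable metric space has at most continuum many points, so for \<open>'a = real\<close>
  (or any type at least as large) every geometric data set is represented.\<close>

definition gds_iso_rel :: "('a gds \<times> 'a gds) set" where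
  "gds_iso_rel = {(X, Y). geometric_data_set X \<and> geometric_data_set Y \<and> gds_isomorphic X Y}"

definition gds_classes :: "'a gds set set" where
  "gds_classes = {X. geometric_data_set X} // gds_iso_rel"

subsection \<open>mm-spaces\<close>

record 'a mm =
  mmet :: "'a metric"
  mmeas :: "'a measure"

definition mm_space :: "'a mm \<Rightarrow> bool" where
  "mm_space X \<longleftrightarrow>
     mcomplete_of (mmet X) \<and> separable_space (mtopology_of (mmet X)) \<and>
     prob_space (mmeas X) \<and> space (mmeas X) = mspace (mmet X) \<and>
     sets (mmeas X) = sets (borel_of (mtopology_of (mmet X))) \<and>
     (\<forall>U. openin (mtopology_of (mmet X)) U \<and> U \<noteq> {} \<longrightarrow> measure (mmeas X) U > 0)"

definition Lip1 :: "'a metric \<Rightarrow> ('a \<Rightarrow> real) set" where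
  "Lip1 m = {f \<in> extensional (mspace m).
     \<forall>x\<in>mspace m. \<forall>y\<in>mspace m. \<bar>f x - f y\<bar> \<le> mdist m x y}"

definition gds_of_mm :: "'a mm \<Rightarrow> 'a gds" where
  "gds_of_mm X = \<lparr>pts = mspace (mmet X), feats = Lip1 (mmet X), gmeas = mmeas X\<rparr>"

definition mm_classes :: "'a gds set set" where
  "mm_classes = {C \<in> gds_classes. \<exists>X. mm_space X \<and> gds_of_mm X \<in> C}"

subsection \<open>Distances\<close>

text \<open>The suprema below are only taken of bounded sets: all the distances involved are at
  most \<open>1\<close>.\<close>

definition Hausdorff_dist :: "('x \<Rightarrow> 'x \<Rightarrow> real) \<Rightarrow> 'x set \<Rightarrow> 'x set \<Rightarrow> real" where
  "Hausdorff_dist d A B = max (SUP a\<in>A. INF b\<in>B. d a b) (SUP b\<in>B. INF a\<in>A. d a b)"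

definition L1_dist :: "'a measure \<Rightarrow> ('a \<Rightarrow> real) \<Rightarrow> ('a \<Rightarrow> real) \<Rightarrow> real" where
  "L1_dist \<pi> u v = (LINT z|\<pi>. \<bar>u z - v z\<bar>)"

definition KyFan_dist :: "'a measure \<Rightarrow> ('a \<Rightarrow> real) \<Rightarrow> ('a \<Rightarrow> real) \<Rightarrow> real" where
  "KyFan_dist \<xi> u v = Inf {\<epsilon>. 0 \<le> \<epsilon> \<and> measure \<xi> {z \<in> space \<xi>. \<bar>u z - v z\<bar> > \<epsilon>} \<le> \<epsilon>}"

definition couplings :: "'a gds \<Rightarrow> 'b gds \<Rightarrow> ('a \<times> 'b) measure set" where
  "couplings X Y = {\<pi>. prob_space \<pi> \<and>
     space \<pi> = pts X \<times> pts Y \<and>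
     sets \<pi> = sets (borel_of (prod_topology (gds_topology X) (gds_topology Y))) \<and>
     distr \<pi> (gmeas X) fst = gmeas X \<and> distr \<pi> (gmeas Y) snd = gmeas Y}"

definition tau :: "real \<Rightarrow> real" where
  "tau r = tanh r / 2"

definition K_tau :: "'a gds \<Rightarrow> ('a \<Rightarrow> real) set" where
  "K_tau X = powertop_real (pts X) closure_of ((\<lambda>f. compose (pts X) tau f) ` feats X)"

definition D_tau :: "('a \<times> 'b) measure \<Rightarrow> 'a gds \<Rightarrow> 'b gds \<Rightarrow> real" where
  "D_tau \<pi> X Y = Hausdorff_dist (L1_dist \<pi>)
     ((\<lambda>u. compose (pts X \<times> pts Y) u fst) ` K_tau X)
     ((\<lambda>v. compose (pts X \<times> pts Y) v snd) ` K_tau Y)"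

definition d_tau :: "'a gds \<Rightarrow> 'b gds \<Rightarrow> real" where
  "d_tau X Y = (INF \<pi>\<in>couplings X Y. D_tau \<pi> X Y)"

definition unit_lebesgue :: "real measure" where
  "unit_lebesgue = restrict_space lborel {0..<1}"

definition parameters :: "'a measure \<Rightarrow> (real \<Rightarrow> 'a) set" where
  "parameters \<mu> = {\<phi>. \<phi> \<in> unit_lebesgue \<rightarrow>\<^sub>M \<mu> \<and> distr unit_lebesgue \<mu> \<phi> = \<mu>}"

definition d_conc :: "'a gds \<Rightarrow> 'b gds \<Rightarrow> real" where
  "d_conc X Y = (INF (\<phi>, \<psi>)\<in>parameters (gmeas X) \<times> parameters (gmeas Y).
     Hausdorff_dist (KyFan_dist unit_lebesgue)
       ((\<lambda>f. compose {0..<1} f \<phi>) ` feats X)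
       ((\<lambda>g. compose {0..<1} g \<psi>) ` feats Y))"

subsection \<open>Induced topologies on isomorphism classes\<close>

definition class_dist :: "('a gds \<Rightarrow> 'a gds \<Rightarrow> real) \<Rightarrow> 'a gds set \<Rightarrow> 'a gds set \<Rightarrow> real" where
  "class_dist d C C' = d (SOME X. X \<in> C) (SOME Y. Y \<in> C')"

text \<open>For a metric this is \<open>Metric_space.mtopology\<close>, see the lemma below; unlike that constant
  it has an unconditional defining equation.\<close>

definition dist_topology :: "'x set \<Rightarrow> ('x \<Rightarrow> 'x \<Rightarrow> real) \<Rightarrow> 'x topology" where
  "dist_topology S d = topology (\<lambda>U. U \<subseteq> S \<and> (\<forall>x\<in>U. \<exists>r>0. {y \<in> S. d x y < r} \<subseteq> U))"

lemma openin_dist_topology: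
  "openin (dist_topology S d) U \<longleftrightarrow> U \<subseteq> S \<and> (\<forall>x\<in>U. \<exists>r>0. {y \<in> S. d x y < r} \<subseteq> U)"
proof -
  define P where "P U \<longleftrightarrow> U \<subseteq> S \<and> (\<forall>x\<in>U. \<exists>r>0. {y \<in> S. d x y < r} \<subseteq> U)" for U
  have "P (U \<inter> V)" if U: "P U" and V: "P V" for U V
    unfolding P_def
  proof (intro conjI ballI)
    show "U \<inter> V \<subseteq> S" using U by (auto simp: P_def)
    fix x assume x: "x \<in> U \<inter> V"
    from U x obtain r where r: "r > 0" "{y \<in> S. d x y < r} \<subseteq> U"
      unfolding P_def by blast
    from V x obtain s where s: "s > 0" "{y \<in> S. d x y < s} \<subseteq> V"
      unfolding P_def by blast
    show "\<exists>r>0. {y \<in> S. d x y < r} \<subseteq> U \<inter> V"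
      using r s by (intro exI[of _ "min r s"]) auto
  qed
  moreover have "P (\<Union>\<U>)" if \<U>: "\<forall>U\<in>\<U>. P U" for \<U>
    unfolding P_def
  proof (intro conjI ballI)
    show "\<Union>\<U> \<subseteq> S" using \<U> by (auto simp: P_def)
    fix x assume "x \<in> \<Union>\<U>"
    then obtain U where U: "U \<in> \<U>" "x \<in> U" by blast
    with \<U> obtain r where "r > 0" "{y \<in> S. d x y < r} \<subseteq> U"
      unfolding P_def by blast
    with U show "\<exists>r>0. {y \<in> S. d x y < r} \<subseteq> \<Union>\<U>" by blast
  qed
  ultimately have "istopology P"
    by (simp add: istopology_def)
  moreover have "dist_topology S d = topology P"
    unfolding dist_topology_def P_def ..
  ultimately show ?thesis
    by (simp add: topology_inverse' P_def)
qed

lemma dist_topology_eq_mtopology: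
  assumes "Metric_space S d"
  shows "dist_topology S d = Metric_space.mtopology S d"
proof -
  interpret Metric_space S d by fact
  have "mball x r = {y \<in> S. d x y < r}" if "x \<in> S" for x r
    using that by (auto simp: mball_def)
  then have "(\<forall>x\<in>U. \<exists>r>0. {y \<in> S. d x y < r} \<subseteq> U) \<longleftrightarrow> (\<forall>x. x \<in> U \<longrightarrow> (\<exists>r>0. mball x r \<subseteq> U))"
    if "U \<subseteq> S" for U
    using that by (simp add: Ball_def subsetD cong: imp_cong)
  then show ?thesis
    by (auto simp: topology_eq openin_dist_topology openin_mtopology)
qed

subsection \<open>An mm-space is a geometric data set\<close>

lemma feat_dist_gds_of_mm:
  assumes x: "x \<in> mspace (mmet X)" and y: "y \<in> mspace (mmet X)"
  shows "feat_dist (gds_of_mm X) x y = mdist (mmet X) x y"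
proof -
  let ?m = "mmet X"
  define g where "g = restrict (\<lambda>z. mdist ?m z y) (mspace ?m)"
  have "\<bar>mdist ?m a y - mdist ?m b y\<bar> \<le> mdist ?m a b" if "a \<in> mspace ?m" "b \<in> mspace ?m" for a b
    using mdist_triangle[of a ?m b y] mdist_triangle[of b ?m a y] that y
    by (simp add: mdist_commute[of ?m b a])
  then have g: "g \<in> Lip1 ?m"
    by (simp add: Lip1_def g_def)
  have "(SUP f\<in>Lip1 ?m. \<bar>f x - f y\<bar>) = mdist ?m x y"
  proof (rule cSup_eq_maximum)
    have "mdist ?m y y = 0" "mdist ?m x y \<ge> 0" using y by simp_all
    moreover have "g x = mdist ?m x y" "g y = mdist ?m y y" using x y by (simp_all add: g_def)
    ultimately have "\<bar>g x - g y\<bar> = mdist ?m x y" by linarith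
    with g show "mdist ?m x y \<in> (\<lambda>f. \<bar>f x - f y\<bar>) ` Lip1 ?m" by (intro image_eqI[of _ _ g]) auto
    show "\<And>r. r \<in> (\<lambda>f. \<bar>f x - f y\<bar>) ` Lip1 ?m \<Longrightarrow> r \<le> mdist ?m x y"
      using x y by (auto simp: Lip1_def)
  qed
  then show ?thesis
    using x y by (simp add: feat_dist_def gds_of_mm_def)
qed

lemma geometric_data_set_gds_of_mm:
  assumes "mm_space X"
  shows "geometric_data_set (gds_of_mm X)"
proof -
  let ?m = "mmet X" and ?G = "gds_of_mm X"
  have [simp]: "pts ?G = mspace ?m" "feats ?G = Lip1 ?m" "gmeas ?G = mmeas X"
    by (simp_all add: gds_of_mm_def)
  interpret A: Metric_space "mspace ?m" "mdist ?m" by simp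
  have d: "feat_dist ?G x y = mdist ?m x y" if "x \<in> mspace ?m" "y \<in> mspace ?m" for x y
    using that by (rule feat_dist_gds_of_mm)
  have d0: "feat_dist ?G x y = 0" if "\<not> (x \<in> mspace ?m \<and> y \<in> mspace ?m)" for x y
    using that by (auto simp: feat_dist_def)
  interpret B: Metric_space "mspace ?m" "feat_dist ?G"
  proof
    show "0 \<le> feat_dist ?G x y" for x y
      by (cases "x \<in> mspace ?m \<and> y \<in> mspace ?m") (simp_all add: d d0)
    show "feat_dist ?G x y = feat_dist ?G y x" for x y
      by (cases "x \<in> mspace ?m \<and> y \<in> mspace ?m") (auto simp: d d0 mdist_commute)
  qed (simp_all add: d mdist_triangle)
  have ball: "B.mball x r = A.mball x r" for x r
    by (auto simp: d)
  have top: "gds_topology ?G = mtopology_of ?m"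
    unfolding gds_topology_def mtopology_of_def
    by (simp add: topology_eq A.openin_mtopology B.openin_mtopology ball)
  have cauchy: "B.MCauchy \<sigma> \<longleftrightarrow> A.MCauchy \<sigma>" for \<sigma>
  proof (cases "range \<sigma> \<subseteq> mspace ?m")
    case True
    then have "feat_dist ?G (\<sigma> i) (\<sigma> j) = mdist ?m (\<sigma> i) (\<sigma> j)" for i j
      by (intro d) auto
    then show ?thesis by (simp add: B.MCauchy_def A.MCauchy_def)
  qed (simp add: B.MCauchy_def A.MCauchy_def)
  have "B.mtopology = A.mtopology"
    using top by (simp add: gds_topology_def mtopology_of_def)
  then have complete: "B.mcomplete \<longleftrightarrow> A.mcomplete"
    by (simp add: A.mcomplete_def B.mcomplete_def cauchy)
  have "(\<lambda>x\<in>mspace ?m. 0) \<in> Lip1 ?m"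
    by (simp add: Lip1_def)
  then have "Lip1 ?m \<noteq> {}" by blast
  moreover have "bdd_above ((\<lambda>f. \<bar>f x - f y\<bar>) ` Lip1 ?m)"
    if "x \<in> mspace ?m" "y \<in> mspace ?m" for x y
    using that by (intro bdd_aboveI[of _ "mdist ?m x y"]) (auto simp: Lip1_def)
  moreover have "Lip1 ?m \<subseteq> extensional (mspace ?m)"
    by (auto simp: Lip1_def)
  ultimately show ?thesis
    using assms complete B.Metric_space_axioms
    by (simp add: geometric_data_set_def mm_space_def top mcomplete_of_def)
qed

end

theory Submission
  imports Defs
begin

text \<open>Every coupling of two complete separable spaces is the law of a pair of parameters, so both
  distances compare features along a common pair of parameters. Since \<open>tau\<close> is bounded and Lipschitz,
  closeness in measure of features gives closeness of their images under \<open>tau\<close> in the mean. Conversely,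
  \<open>tau\<close> flattens features of large size, but the features of an mm-space are closed under adding
  constants: on the fixed limit space a feature is normalised to vanish at a base point, and on the
  varying space to have median near \<open>0\<close>. The inverse of \<open>tau\<close> is uniformly continuous on the range
  of the normalised features over a ball of nearly full measure in the limit space. For an arbitrary
  representative of the class of an mm-space, adding a constant to a feature only stays in the pointwise
  closure of the features; as all features are Lipschitz and the space is separable, the features are
  dense in that closure with respect to convergence in measure.\<close>

section \<open>Borel structures of separable metric spaces\<close>

text \<open>The two implications differ in strength. Closeness for \<open>d_conc\<close> gives
  closeness for \<open>d_tau\<close> with the universal factor 3, for all geometric data sets. In
  the converse the modulus depends on the limit space, through a radius \<open>R\<close> of a ball
  of nearly full mass and a number \<eta> measuring how flat tau is on the values reached there. It
  is therefore fixed before the varying space appears, and the topologies are compared ball by ball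
  with a radius depending on the centre. \<open>class_dist\<close> evaluates the distances at chosen
  representatives, which need not be of the form \<open>gds_of_mm\<close>. What every representative
  of an mm-class inherits is \<open>lip_saturated\<close>: all functions that are 1-Lipschitz for
  the feature metric lie in the pointwise closure of the features. An isomorphism is shown to be a
  bijective isometry in order to transport this property.\<close>

lemma space_borel_of [simp]: "space (borel_of T) = topspace T"
  by (auto simp: borel_of_def space_measure_of_conv)

lemma sets_borel_of: "sets (borel_of T) = sigma_sets (topspace T) {U. openin T U}"
  unfolding borel_of_def by (rule sets_measure_of) (auto dest: openin_subset)

lemma openin_imp_sets_borel_of: "openin T U \<Longrightarrow> U \<in> sets (borel_of T)"
  by (auto simp: sets_borel_of)

lemma measurable_borel_ofI:
  assumes "f \<in> space M \<rightarrow> topspace T"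
    and "\<And>U. openin T U \<Longrightarrow> f -` U \<inter> space M \<in> sets M"
  shows "f \<in> M \<rightarrow>\<^sub>M borel_of T"
  unfolding borel_of_def
  using assms by (intro measurable_measure_of) (auto dest: openin_subset)

lemma measurable_borel_of_continuous_map:
  assumes "continuous_map T S f"
  shows "f \<in> borel_of T \<rightarrow>\<^sub>M borel_of S"
proof (rule measurable_borel_ofI)
  show "f \<in> space (borel_of T) \<rightarrow> topspace S"
    using assms by (auto simp: continuous_map_def)
  show "f -` U \<inter> space (borel_of T) \<in> sets (borel_of T)" if "openin S U" for U
  proof -
    have "openin T {x \<in> topspace T. f x \<in> U}"
      using assms that by (rule openin_continuous_map_preimage)
    moreover have "f -` U \<inter> space (borel_of T) = {x \<in> topspace T. f x \<in> U}" by auto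
    ultimately show ?thesis by (auto intro: openin_imp_sets_borel_of)
  qed
qed

text \<open>Separability in indexed form, repetitions allowed: together with the radii
  \<open>1/2^n\<close> it enumerates a countable base of balls.\<close>

definition dense_seq :: "'a set \<Rightarrow> ('a \<Rightarrow> 'a \<Rightarrow> real) \<Rightarrow> (nat \<Rightarrow> 'a) \<Rightarrow> bool" where
  "dense_seq M d z \<longleftrightarrow> range z \<subseteq> M \<and> (\<forall>x\<in>M. \<forall>e>0. \<exists>i. d x (z i) < e)"

context Metric_space
begin

lemma separable_imp_dense_seq:
  assumes "separable_space mtopology" "M \<noteq> {}"
  shows "\<exists>z. dense_seq M d z"
proof -
  obtain C where C: "countable C" "C \<subseteq> M" "mtopology closure_of C = M"
    using assms(1) by (auto simp: separable_space_def)
  then have "C \<noteq> {}" using assms(2) by auto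
  have "\<exists>i. d x (from_nat_into C i) < e" if "x \<in> M" "e > 0" for x e
  proof -
    have "x \<in> mtopology closure_of C" using C that by simp
    then obtain y where "y \<in> C" "y \<in> mball x e"
      using \<open>e > 0\<close> unfolding metric_closure_of by blast
    then show ?thesis
      using C(1) by (metis from_nat_into_surj in_mball)
  qed
  moreover have "range (from_nat_into C) \<subseteq> M"
    using C(2) from_nat_into[OF \<open>C \<noteq> {}\<close>] by blast
  ultimately show ?thesis unfolding dense_seq_def by blast
qed

text \<open>If the ball of radius r around x lies in U, a radius below r/2 and a centre closer to x
  than that radius give a ball that contains x and stays within distance r of it.\<close>

lemma openin_dense_balls:
  assumes "dense_seq M d z" "openin mtopology U" "x \<in> U"
  shows "\<exists>i n. x \<in> mball (z i) (1/2^n) \<and> mball (z i) (1/2^n) \<subseteq> U"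
proof -
  obtain r where r: "r > 0" "mball x r \<subseteq> U" "x \<in> M"
    using assms(2,3) unfolding openin_mtopology by blast
  obtain n where n: "1 / 2 ^ n < r / 2"
    using r real_arch_pow_inv[of "r/2" "1/2"] by (auto simp: power_one_over)
  obtain i where i: "d x (z i) < 1/2^n"
    using assms(1) r(3) unfolding dense_seq_def by (metis zero_less_divide_1_iff zero_less_numeral zero_less_power)
  have zi: "z i \<in> M" using assms(1) by (auto simp: dense_seq_def)
  have "x \<in> mball (z i) (1/2^n)" using i zi r by (simp add: commute)
  moreover have "mball (z i) (1/2^n) \<subseteq> mball x r"
    using i n zi r by (intro mball_subset) (auto simp: commute)
  ultimately show ?thesis using r by blast
qed

text \<open>An open set is a countable union of base balls, and the preimage of a ball is a sublevel
  set of a distance function. This reduces measurability of limits and of pairs of maps to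
  real-valued functions.\<close>

lemma measurable_borel_of_mtopologyI:
  assumes z: "dense_seq M d z"
    and f: "f \<in> space N \<rightarrow> M"
    and m: "\<And>i. (\<lambda>w. d (z i) (f w)) \<in> borel_measurable N"
  shows "f \<in> N \<rightarrow>\<^sub>M borel_of mtopology"
proof (rule measurable_borel_ofI)
  show "f \<in> space N \<rightarrow> topspace mtopology" using f by simp
  fix U assume U: "openin mtopology U"
  define I where "I = {(i,n). mball (z i) (1/2^n) \<subseteq> U}"
  have zM: "z i \<in> M" for i using z by (auto simp: dense_seq_def)
  have "f -` U \<inter> space N = (\<Union>(i,n)\<in>I. {w \<in> space N. d (z i) (f w) < 1/2^n})"
  proof (intro equalityI subsetI)
    fix w assume w: "w \<in> f -` U \<inter> space N"
    then obtain i n where "f w \<in> mball (z i) (1/2^n)" "mball (z i) (1/2^n) \<subseteq> U"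
      using openin_dense_balls[OF z U, of "f w"] by auto
    then show "w \<in> (\<Union>(i,n)\<in>I. {w \<in> space N. d (z i) (f w) < 1/2^n})"
      using w by (auto simp: I_def)
  next
    fix w assume "w \<in> (\<Union>(i,n)\<in>I. {w \<in> space N. d (z i) (f w) < 1/2^n})"
    then obtain i n where "mball (z i) (1/2^n) \<subseteq> U" "w \<in> space N" "d (z i) (f w) < 1/2^n"
      by (auto simp: I_def)
    moreover from this have "f w \<in> mball (z i) (1/2^n)" using f zM[of i] by auto
    ultimately show "w \<in> f -` U \<inter> space N" by blast
  qed
  also have "\<dots> \<in> sets N"
    using m by (intro sets.countable_UN'') auto
  finally show "f -` U \<inter> space N \<in> sets N" .
qed

end

section \<open>Lebesgue measure on [0,1) and quantile functions\<close>

lemma prob_space_unit_lebesgue: "prob_space unit_lebesgue"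
  unfolding unit_lebesgue_def
  by (auto simp: emeasure_restrict_space space_restrict_space intro!: prob_spaceI)

lemma space_unit_lebesgue [simp]: "space unit_lebesgue = {0..<1}"
  by (simp add: unit_lebesgue_def space_restrict_space)

text \<open>The generalised inverse \<open>I\<close> of the distribution function carries Lebesgue
  measure on the open unit interval to \<open>M\<close>; the endpoint 0 is a null set.\<close>

lemma unit_lebesgue_quantile:
  assumes "real_distribution M"
  shows "\<exists>q. q \<in> borel_measurable unit_lebesgue \<and> distr unit_lebesgue borel q = M"
proof -
  interpret cdf_distribution M using assms by (simp add: cdf_distribution_def)
  let ?\<Omega> = "restrict_space lborel {0<..<1::real}"
  \<comment> \<open>The value 0 outside the open interval is a mere default; it extends the quantile
    function to the point 0 of [0,1).\<close>
  define q where "q w = (if w \<in> {0<..<1} then I w else 0)" for w :: real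
  have I: "I \<in> borel_measurable ?\<Omega>"
    using measurable_CI by (simp add: measurable_cong_sets[OF sets_restrict_space_cong[OF sets_lborel] refl])
  have q: "q \<in> borel_measurable lborel"
  proof -
    have "q = (\<lambda>x. indicator {0<..<1} x *\<^sub>R I x)"
      by (auto simp: q_def indicator_def)
    then show ?thesis
      using I by (subst (asm) borel_measurable_restrict_space_iff) auto
  qed
  then have qu: "q \<in> borel_measurable unit_lebesgue"
    unfolding unit_lebesgue_def by (rule measurable_restrict_space1)
  have "distr unit_lebesgue borel q = distr ?\<Omega> borel I"
  proof (rule measure_eqI)
    fix A assume "A \<in> sets (distr unit_lebesgue borel q)"
    then have A: "A \<in> sets borel" by simp
    have A1: "q -` A \<inter> {0..<1} \<in> sets lborel"
      using measurable_sets[OF q A] by auto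
    have A2: "q -` A \<inter> {0<..<1} \<in> sets lborel"
      using measurable_sets[OF q A] by auto
    have eq: "I -` A \<inter> {0<..<1} = q -` A \<inter> {0<..<1}"
      by (auto simp: q_def)
    have "emeasure (distr unit_lebesgue borel q) A = emeasure lborel (q -` A \<inter> {0..<1})"
      using A1 by (subst emeasure_distr[OF qu A])
        (simp add: unit_lebesgue_def space_restrict_space emeasure_restrict_space)
    also have "\<dots> = emeasure lborel (q -` A \<inter> {0<..<1})"
      using A1 A2 AE_lborel_singleton[of "0::real"] 
      by (intro emeasure_eq_AE) (auto elim!: eventually_mono)
    also have "\<dots> = emeasure (distr ?\<Omega> borel I) A"
      using A2 by (subst emeasure_distr[OF I A]) (simp add: space_restrict_space emeasure_restrict_space eq)
    finally show "emeasure (distr unit_lebesgue borel q) A = emeasure (distr ?\<Omega> borel I) A" .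
  qed simp
  with distr_I_eq_M qu show ?thesis by auto
qed

section \<open>Lebesgue parameters of measures on complete separable metric spaces\<close>

text \<open>Shift map on expansions with digits 0 and 1 in base 3: remove the leading digit,
  recognised by the comparison with 1, and multiply by 3.\<close>

fun ternary_tail :: "real \<Rightarrow> nat \<Rightarrow> real" where
  "ternary_tail y 0 = y"
| "ternary_tail y (Suc k) = 3 * (ternary_tail y k - (if ternary_tail y k \<ge> 1 then 1 else 0))"

definition ternary_code :: "(nat \<Rightarrow> bool) \<Rightarrow> real" where
  "ternary_code b = (\<Sum>j. of_bool (b j) / 3 ^ j)"

lemma summable_ternary: "summable (\<lambda>j. of_bool (b j) / 3 ^ j :: real)"
proof (rule summable_comparison_test)
  show "\<exists>N. \<forall>n\<ge>N. norm (of_bool (b n) / 3 ^ n :: real) \<le> (1/3)^n"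
    by (auto simp: power_one_over)
  show "summable (\<lambda>n. (1/3)^n :: real)" by (simp add: summable_geometric)
qed

lemma ternary_code_Suc: "ternary_code b = of_bool (b 0) + ternary_code (\<lambda>j. b (Suc j)) / 3"
proof -
  have "ternary_code b = of_bool (b 0) + (\<Sum>j. of_bool (b (Suc j)) / 3 ^ Suc j)"
    unfolding ternary_code_def using suminf_split_head[OF summable_ternary[of b]] by simp
  also have "(\<Sum>j. of_bool (b (Suc j)) / 3 ^ Suc j :: real) = (\<Sum>j. of_bool (b (Suc j)) / 3 ^ j / 3)"
    by (simp add: field_simps)
  also have "\<dots> = ternary_code (\<lambda>j. b (Suc j)) / 3"
    unfolding ternary_code_def by (rule suminf_divide[OF summable_ternary])
  finally show ?thesis .
qed

lemma ternary_code_bounds: "0 \<le> ternary_code b" "ternary_code b \<le> 3/2"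
proof -
  show "0 \<le> ternary_code b"
    unfolding ternary_code_def by (intro suminf_nonneg summable_ternary) auto
  have "ternary_code b \<le> (\<Sum>j. (1/3)^j)"
    unfolding ternary_code_def
    by (intro suminf_le summable_ternary summable_geometric) (auto simp: power_one_over)
  also have "\<dots> = 3/2" by (subst suminf_geometric) auto
  finally show "ternary_code b \<le> 3/2" .
qed

text \<open>With base 3 but only the digits 0 and 1, the tail contributes at most (3/2)/3 = 1/2. A
  vanishing leading digit thus keeps the code below 1, so there is no ambiguity of expansions as in
  base 2.\<close>

lemma ternary_code_ge_1_iff: "ternary_code b \<ge> 1 \<longleftrightarrow> b 0"
  using ternary_code_bounds[of "\<lambda>j. b (Suc j)"] by (cases "b 0") (auto simp: ternary_code_Suc[of b])

lemma ternary_tail_code: "ternary_tail (ternary_code b) k = ternary_code (\<lambda>j. b (k + j))"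
proof (induction k)
  case (Suc k)
  show ?case
    using ternary_code_Suc[of "\<lambda>j. b (k + j)"] ternary_code_ge_1_iff[of "\<lambda>j. b (k + j)"]
    by (auto simp: Suc)
qed simp

lemma ternary_digit: "ternary_tail (ternary_code b) k \<ge> 1 \<longleftrightarrow> b k"
  by (simp add: ternary_tail_code ternary_code_ge_1_iff)

lemma measurable_ternary_tail [measurable]: "(\<lambda>y. ternary_tail y k) \<in> borel_measurable borel"
  by (induction k) auto

context Metric_space
begin

text \<open>The indicators of a countable base of balls are written as the ternary digits of one real
  number. Decoding is a limit of countably-valued maps, defined on all of the reals, so
  Borel measurability of the range of the code is never needed.\<close>

lemma ex_measurable_real_code:
  assumes complete: "mcomplete" and z: "dense_seq M d z"
  shows "\<exists>c r. c \<in> borel_of mtopology \<rightarrow>\<^sub>M (borel :: real measure) \<and>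
     r \<in> (borel :: real measure) \<rightarrow>\<^sub>M borel_of mtopology \<and> (\<forall>x\<in>M. r (c x) = x)"
proof -
  have zM: "z i \<in> M" for i using z by (auto simp: dense_seq_def)
  define E where "E k = mball (z (fst (prod_decode k))) (1/2^(snd (prod_decode k)))" for k
  define c where "c x = ternary_code (\<lambda>k. x \<in> E k)" for x
  define D where "D i n y \<longleftrightarrow> ternary_tail y (prod_encode (i,n)) \<ge> 1" for i n y
  have D_c: "D i n (c x) \<longleftrightarrow> x \<in> mball (z i) (1/2^n)" for i n x
    by (simp add: D_def c_def ternary_digit E_def)
  have [measurable]: "E k \<in> sets (borel_of mtopology)" for k
    unfolding E_def by (intro openin_imp_sets_borel_of) auto
  have c: "c \<in> borel_of mtopology \<rightarrow>\<^sub>M borel"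
    unfolding c_def ternary_code_def by measurable
  \<comment> \<open>On codes of points this is the first centre within \<open>1/2^n\<close>.
    Elsewhere no index need exist and the value is arbitrary; \<open>G\<close> filters out the reals
    on which the resulting sequence fails to be Cauchy.\<close>
  define a where "a n y = (LEAST i. D i n y)" for n y
  have [measurable]: "a n \<in> borel \<rightarrow>\<^sub>M count_space UNIV" for n
    unfolding a_def D_def by measurable
  define s where "s n y = z (a n y)" for n y
  have sM: "s n y \<in> M" for n y by (simp add: s_def zM)
  \<comment> \<open>The Cauchy condition, written with countably many quantifiers so that it defines
    a Borel set of reals.\<close>
  define G where "G y \<longleftrightarrow> (\<forall>k. \<exists>N. \<forall>m\<ge>N. \<forall>n\<ge>N. d (s m y) (s n y) < 1 / 2^k)" for y
  have [measurable]: "Measurable.pred borel G"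
    unfolding G_def s_def by measurable
  have G_lim: "\<exists>l. limitin mtopology (\<lambda>n. s n y) l sequentially" if "G y" for y
  proof -
    have "MCauchy (\<lambda>n. s n y)"
      unfolding MCauchy_def
    proof (intro conjI allI impI)
      show "range (\<lambda>n. s n y) \<subseteq> M" using sM by auto
      fix e :: real assume "e > 0"
      then obtain k where "1 / 2 ^ k < e"
        using real_arch_pow_inv[of e "1/2"] by (auto simp: power_one_over)
      moreover obtain N where "\<forall>m\<ge>N. \<forall>n\<ge>N. d (s m y) (s n y) < 1 / 2^k"
        using \<open>G y\<close> unfolding G_def by blast
      ultimately show "\<exists>N. \<forall>n n'. N \<le> n \<longrightarrow> N \<le> n' \<longrightarrow> d (s n y) (s n' y) < e"
        by (meson less_trans)
    qed
    then show ?thesis using complete by (simp add: mcomplete_def)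
  qed
  \<comment> \<open>The default \<open>z 0\<close> makes the decoder total with values in
    \<open>M\<close>.\<close>
  define r where "r y = (if G y then SOME l. limitin mtopology (\<lambda>n. s n y) l sequentially else z 0)" for y
  have r_lim: "limitin mtopology (\<lambda>n. s n y) (r y) sequentially" if "G y" for y
    using someI_ex[OF G_lim[OF that]] that by (simp add: r_def)
  have rM: "r y \<in> M" for y
    using r_lim[of y] zM limitin_topspace[of mtopology] by (cases "G y") (auto simp: r_def)
  have d_lim: "(\<lambda>n. d x (s n y)) \<longlonglongrightarrow> d x l"
    if lim: "limitin mtopology (\<lambda>n. s n y) l sequentially" and xM: "x \<in> M" for x y l
  proof (rule metric_LIMSEQ_I)
    fix e :: real assume "e > 0"
    have l: "l \<in> M" using lim limitin_topspace[of mtopology] by auto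
    obtain N where "\<forall>n\<ge>N. d (s n y) l < e"
      using lim \<open>e > 0\<close> unfolding limit_metric_sequentially by blast
    then have "\<forall>n\<ge>N. dist (d x (s n y)) (d x l) < e"
      using mdist_reverse_triangle[OF xM sM l, of _ y] triangle[OF xM sM l]
        triangle[OF xM l sM] commute
      by (smt (verit, del_insts) dist_real_def)
    then show "\<exists>N. \<forall>n\<ge>N. dist (d x (s n y)) (d x l) < e" by blast
  qed
  have r: "r \<in> borel \<rightarrow>\<^sub>M borel_of mtopology"
  proof (rule measurable_borel_of_mtopologyI[OF z])
    show "r \<in> space borel \<rightarrow> M" using rM by auto
    fix i
    \<comment> \<open>Continuity of the distance turns the unspecified choice of a limit point into
      a pointwise limit of real functions, for which measurability is available.\<close>
    have "(\<lambda>y. d (z i) (r y)) = (\<lambda>y. if G y then lim (\<lambda>n. d (z i) (s n y)) else d (z i) (z 0))"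
    proof
      show "d (z i) (r y) = (if G y then lim (\<lambda>n. d (z i) (s n y)) else d (z i) (z 0))" for y
        by (cases "G y") (simp_all add: limI[OF d_lim[OF r_lim zM]], simp add: r_def)
    qed
    also have "\<dots> \<in> borel_measurable borel"
      unfolding s_def by measurable
    finally show "(\<lambda>y. d (z i) (r y)) \<in> borel_measurable borel" .
  qed
  have rc: "r (c x) = x" if x: "x \<in> M" for x
  proof -
    \<comment> \<open>By density some base ball of radius \<open>1/2^n\<close> contains x, and the
      digits of \<open>c x\<close> record this, so the least index selects a correct centre.\<close>
    have *: "d (s n (c x)) x < 1/2^n" for n
    proof -
      have "\<exists>i. d x (z i) < 1/2^n"
        using z x by (simp add: dense_seq_def)
      then have "\<exists>i. D i n (c x)"
        using x zM by (auto simp: D_c commute)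
      then have "D (a n (c x)) n (c x)"
        unfolding a_def by (rule LeastI_ex)
      then show ?thesis by (simp add: D_c s_def)
    qed
    have lim: "limitin mtopology (\<lambda>n. s n (c x)) x sequentially"
      unfolding limit_metric_sequentially
    proof (intro conjI allI impI x)
      fix e :: real assume "e > 0"
      then obtain N where N: "1 / 2 ^ N < e"
        using real_arch_pow_inv[of e "1/2"] by (auto simp: power_one_over)
      have "d (s n (c x)) x < e" if "n \<ge> N" for n
      proof -
        have "(1::real) / 2^n \<le> 1 / 2^N" using that by (simp add: field_simps)
        then show ?thesis using *[of n] N by linarith
      qed
      then show "\<exists>N. \<forall>n\<ge>N. s n (c x) \<in> M \<and> d (s n (c x)) x < e" using sM by blast
    qed
    then have "MCauchy (\<lambda>n. s n (c x))"
      using sM by (intro convergent_imp_MCauchy) auto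
    then have "G (c x)"
      unfolding G_def MCauchy_def by (simp add: less_imp_le)
    then show ?thesis
      using limitin_metric_unique[OF r_lim lim] by simp
  qed
  show ?thesis using c r rc by blast
qed

text \<open>Encode the measure on the real line, represent the image by its quantile function, and
  decode. Since decoding after encoding is the identity on \<open>M\<close>, the original law
  returns.\<close>

lemma parameters_nonempty:
  assumes "mcomplete" and z: "dense_seq M d z"
    and "prob_space \<mu>" and sets: "sets \<mu> = sets (borel_of mtopology)"
  shows "parameters \<mu> \<noteq> {}"
proof -
  interpret prob_space \<mu> by fact
  obtain c :: "'a \<Rightarrow> real" and r where c: "c \<in> borel_of mtopology \<rightarrow>\<^sub>M borel"
    and r: "r \<in> borel \<rightarrow>\<^sub>M borel_of mtopology" and rc: "\<forall>x\<in>M. r (c x) = x"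
    using ex_measurable_real_code[OF assms(1) z] by blast
  have c': "c \<in> \<mu> \<rightarrow>\<^sub>M borel" and r': "r \<in> borel \<rightarrow>\<^sub>M \<mu>"
    using c r measurable_cong_sets[OF sets refl, of "borel :: real measure"]
      measurable_cong_sets[OF refl sets, of "borel :: real measure"] by auto
  have space: "space \<mu> = M" using sets_eq_imp_space_eq[OF sets] by simp
  have "real_distribution (distr \<mu> borel c)"
    using c' by (rule real_distribution_distr)
  then obtain q where q: "q \<in> borel_measurable unit_lebesgue"
    and eq: "distr unit_lebesgue borel q = distr \<mu> borel c"
    using unit_lebesgue_quantile by blast
  have "distr unit_lebesgue \<mu> (r \<circ> q) = distr (distr unit_lebesgue borel q) \<mu> r"
    using q r' by (simp add: distr_distr)
  also have "\<dots> = distr \<mu> \<mu> (r \<circ> c)"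
    unfolding eq using c' r' by (simp add: distr_distr)
  also have "\<dots> = distr \<mu> \<mu> (\<lambda>x. x)"
    using rc by (intro distr_cong) (auto simp: space)
  finally have "distr unit_lebesgue \<mu> (r \<circ> q) = \<mu>" by (simp add: distr_id)
  moreover have "r \<circ> q \<in> unit_lebesgue \<rightarrow>\<^sub>M \<mu>" using q r' by (rule measurable_comp)
  ultimately show ?thesis by (auto simp: parameters_def)
qed

end

section \<open>Pointwise closures and features\<close>

text \<open>A basic open set of the product topology constrains finitely many coordinates, and
  finitely many open conditions admit a common tolerance.\<close>

lemma closure_of_powertop_real_iff:
  assumes F: "F \<subseteq> extensional S"
  shows "u \<in> powertop_real S closure_of F \<longleftrightarrow>
    u \<in> extensional S \<and> (\<forall>I e. finite I \<and> I \<subseteq> S \<and> e > 0 \<longrightarrow> (\<exists>f\<in>F. \<forall>i\<in>I. \<bar>f i - u i\<bar> < e))"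
    (is "?L \<longleftrightarrow> ?R")
proof
  assume u: ?L
  then have ext: "u \<in> extensional S"
    using closure_of_subset_topspace[of "powertop_real S" F] by (auto simp: PiE_def)
  have "\<exists>f\<in>F. \<forall>i\<in>I. \<bar>f i - u i\<bar> < e" if I: "finite I" "I \<subseteq> S" "e > 0" for I e
  proof -
    define B where "B i = (if i \<in> I then ball (u i) e else UNIV)" for i
    have "openin (powertop_real S) (PiE S B)"
    proof (rule product_topology_basis)
      show "openin euclideanreal (B i)" for i by (simp add: B_def)
      have "{i. B i \<noteq> topspace euclideanreal} \<subseteq> I" by (auto simp: B_def)
      then show "finite {i. B i \<noteq> topspace euclideanreal}" using I(1) finite_subset by blast
    qed
    moreover have "u \<in> PiE S B" using ext I by (simp add: B_def PiE_def)
    ultimately obtain f where f: "f \<in> F" "f \<in> PiE S B"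
      using u unfolding in_closure_of by blast
    have "\<bar>f i - u i\<bar> < e" if "i \<in> I" for i
    proof -
      have "f i \<in> B i" using f(2) I(2) that by (auto dest: PiE_mem)
      then show ?thesis using that by (simp add: B_def dist_real_def)
    qed
    with f(1) show ?thesis by blast
  qed
  with ext show ?R by blast
next
  assume R: ?R
  show ?L unfolding in_closure_of
  proof (intro conjI allI impI)
    show "u \<in> topspace (powertop_real S)" using R by (simp add: PiE_def)
    fix T assume T: "u \<in> T \<and> openin (powertop_real S) T"
    obtain B where B: "u \<in> PiE S B" "\<And>i. openin euclideanreal (B i)"
        "finite {i. B i \<noteq> topspace euclideanreal}" "PiE S B \<subseteq> T"
      using product_topology_open_contains_basis[of "\<lambda>_. euclideanreal" S T u] T by auto
    define I where "I = {i \<in> S. B i \<noteq> UNIV}"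
    have I: "finite I" "I \<subseteq> S"
      using B(3) by (auto simp: I_def elim: finite_subset[rotated])
    have "\<forall>i\<in>I. \<exists>e>0. ball (u i) e \<subseteq> B i"
    proof
      fix i assume "i \<in> I"
      then have "u i \<in> B i" "open (B i)" using B I by (auto dest: PiE_mem)
      then show "\<exists>e>0. ball (u i) e \<subseteq> B i" by (simp add: open_contains_ball)
    qed
    then obtain e where e: "\<forall>i\<in>I. e i > 0 \<and> ball (u i) (e i) \<subseteq> B i" by metis
    \<comment> \<open>Inserting 1 keeps the minimum meaningful when no coordinate is
      constrained.\<close>
    define e0 where "e0 = Min (insert 1 (e ` I))"
    have "e0 > 0" unfolding e0_def using I e by (subst Min_gr_iff) auto
    then obtain f where f: "f \<in> F" "\<forall>i\<in>I. \<bar>f i - u i\<bar> < e0"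
      using R I by blast
    have "f i \<in> B i" if "i \<in> S" for i
    proof (cases "i \<in> I")
      case True
      then have "e0 \<le> e i" unfolding e0_def using I by (intro Min_le) auto
      then have "\<bar>f i - u i\<bar> < e i" using f True by fastforce
      then have "f i \<in> ball (u i) (e i)" by (simp add: dist_real_def abs_minus_commute)
      then show ?thesis using e True by blast
    qed (use that in \<open>auto simp: I_def\<close>)
    then have "f \<in> PiE S B" using f(1) F by (auto simp: PiE_def)
    then show "\<exists>y. y \<in> F \<and> y \<in> T" using f(1) B(4) by blast
  qed
qed

lemma closure_of_powertop_real_superset:
  "F \<subseteq> extensional S \<Longrightarrow> F \<subseteq> powertop_real S closure_of F"
  by (rule closure_of_subset) (auto simp: PiE_def)

lemma closure_of_powertop_real_abs_diff_le:
  assumes F: "F \<subseteq> extensional S" and u: "u \<in> powertop_real S closure_of F"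
    and x: "x \<in> S" and y: "y \<in> S" and le: "\<And>f. f \<in> F \<Longrightarrow> \<bar>f x - f y\<bar> \<le> D"
  shows "\<bar>u x - u y\<bar> \<le> D"
proof (rule field_le_epsilon)
  fix e :: real assume "e > 0"
  then have "\<exists>f\<in>F. \<forall>i\<in>{x,y}. \<bar>f i - u i\<bar> < e/2"
    using u x y unfolding closure_of_powertop_real_iff[OF F]
    by (elim conjE allE[of _ "{x,y}"] allE[of _ "e/2"]) auto
  then obtain f where "f \<in> F" "\<bar>f x - u x\<bar> < e/2" "\<bar>f y - u y\<bar> < e/2" by auto
  then show "\<bar>u x - u y\<bar> \<le> D + e" using le[of f] by linarith
qed

lemma closure_of_powertop_real_abs_le:
  assumes F: "F \<subseteq> extensional S" and u: "u \<in> powertop_real S closure_of F"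
    and x: "x \<in> S" and le: "\<And>f. f \<in> F \<Longrightarrow> \<bar>f x\<bar> \<le> D"
  shows "\<bar>u x\<bar> \<le> D"
proof (rule field_le_epsilon)
  fix e :: real assume "e > 0"
  then have "\<exists>f\<in>F. \<forall>i\<in>{x}. \<bar>f i - u i\<bar> < e"
    using u x unfolding closure_of_powertop_real_iff[OF F]
    by (elim conjE allE[of _ "{x}"] allE[of _ e]) auto
  then obtain f where "f \<in> F" "\<bar>f x - u x\<bar> < e" by auto
  then show "\<bar>u x\<bar> \<le> D + e" using le[of f] by linarith
qed

context Metric_space
begin

text \<open>The topology of pointwise convergence need not be first countable, so closure points are
  not limits of sequences in general. The common Lipschitz bound repairs this: approximate on the
  first n + 1 points of a dense sequence with error \<open>1 / Suc n\<close>, then pass to any point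
  by an e/3 argument. Sequences are needed for dominated convergence.\<close>

lemma closure_of_lipschitz_sequence:
  assumes z: "dense_seq M d z"
    and F: "F \<subseteq> extensional M"
    and lip: "\<And>f x y. f \<in> F \<Longrightarrow> x \<in> M \<Longrightarrow> y \<in> M \<Longrightarrow> \<bar>f x - f y\<bar> \<le> d x y"
    and u: "u \<in> powertop_real M closure_of F"
  shows "\<exists>f. (\<forall>n. f n \<in> F) \<and> (\<forall>x\<in>M. (\<lambda>n. f n x) \<longlonglongrightarrow> u x)"
proof -
  have zM: "z i \<in> M" for i using z by (auto simp: dense_seq_def)
  have "\<forall>n. \<exists>f\<in>F. \<forall>i\<in>z ` {..n}. \<bar>f i - u i\<bar> < 1 / real (Suc n)"
  proof
    fix n
    show "\<exists>f\<in>F. \<forall>i\<in>z ` {..n}. \<bar>f i - u i\<bar> < 1 / real (Suc n)"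
      using u zM unfolding closure_of_powertop_real_iff[OF F]
      by (elim conjE allE[of _ "z ` {..n}"] allE[of _ "1 / real (Suc n)"]) auto
  qed
  then obtain f where f: "\<And>n. f n \<in> F" "\<And>n i. i \<le> n \<Longrightarrow> \<bar>f n (z i) - u (z i)\<bar> < 1 / real (Suc n)"
    by (metis atMost_iff imageI)
  have "(\<lambda>n. f n x) \<longlonglongrightarrow> u x" if x: "x \<in> M" for x
  proof (rule metric_LIMSEQ_I)
    fix e :: real assume "e > 0"
    then obtain i where i: "d x (z i) < e/3"
      using z x unfolding dense_seq_def by (metis divide_pos_pos zero_less_numeral)
    obtain N where N: "1 / real (Suc N) < e/3"
      using nat_approx_posE[of "e/3"] \<open>e > 0\<close> by auto
    have "dist (f n x) (u x) < e" if n: "n \<ge> max i N" for n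
    proof -
      have "1 / real (Suc n) \<le> 1 / real (Suc N)" using n by (simp add: frac_le)
      then have "\<bar>f n (z i) - u (z i)\<bar> < e/3" using f(2)[of i n] N n by simp
      moreover have "\<bar>f n x - f n (z i)\<bar> \<le> d x (z i)" using lip f(1) x zM by blast
      moreover have "\<bar>u x - u (z i)\<bar> \<le> d x (z i)"
        using closure_of_powertop_real_abs_diff_le[OF F u x zM] lip x zM by blast
      ultimately show ?thesis using i unfolding dist_real_def by linarith
    qed
    then show "\<exists>N. \<forall>n\<ge>N. dist (f n x) (u x) < e" by blast
  qed
  with f(1) show ?thesis by blast
qed

end

section \<open>Monotonicity, boundedness and quantitative invertibility of tau\<close>

lemma tau_less_iff [simp]: "tau a < tau b \<longleftrightarrow> a < b"
  by (simp add: tau_def)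

lemma abs_tau_le: "\<bar>tau a\<bar> \<le> 1/2"
  using tanh_real_bounds[of a] by (auto simp: tau_def abs_le_iff)

lemma abs_tau_diff_le_1: "\<bar>tau a - tau b\<bar> \<le> 1"
  using abs_tau_le[of a] abs_tau_le[of b] by linarith

lemma tau_has_derivative: "(tau has_real_derivative (1 - tanh x ^ 2) / 2) (at x)"
  unfolding tau_def by (auto intro!: derivative_eq_intros simp: field_simps)

lemma isCont_tau: "isCont tau x"
  using tau_has_derivative by (rule DERIV_isCont)

lemma continuous_on_tau [continuous_intros]:
  "continuous_on A f \<Longrightarrow> continuous_on A (\<lambda>x. tau (f x))"
  using isCont_tau continuous_at_imp_continuous_on[of UNIV tau] continuous_on_compose2[of UNIV tau A f] by auto

lemma measurable_tau [measurable]: "tau \<in> borel_measurable borel"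
  by (intro borel_measurable_continuous_onI continuous_intros)

lemma tau_0 [simp]: "tau 0 = 0"
  by (simp add: tau_def)

lemma tau_lipschitz: "\<bar>tau a - tau b\<bar> \<le> \<bar>a - b\<bar>"
proof -
  have "norm (tau a - tau b) \<le> 1 * norm (a - b)"
  proof (rule field_differentiable_bound[of UNIV])
    show "(tau has_field_derivative (1 - tanh x ^ 2) / 2) (at x within UNIV)" for x
      using tau_has_derivative[of x] by simp
    have "tanh x ^ 2 \<le> 1" for x :: real
      using tanh_real_bounds[of x] by (auto simp: abs_square_le_1)
    then show "norm ((1 - tanh x ^ 2) / 2) \<le> 1" for x :: real
      by (simp add: abs_if) (smt (verit) zero_le_power2)
  qed auto
  then show ?thesis by simp
qed

text \<open>The gap \<open>h\<close> in tau-values caused by moving \<epsilon> to either side is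
  continuous and positive, hence bounded away from 0 on the compact interval; monotonicity covers
  larger moves. Only \<open>a\<close> is confined to the interval: in the applications
  \<open>b\<close> is the value of a partner feature with no prior bound.\<close>

lemma tau_inverse_uniform:
  assumes "\<epsilon> > 0"
  shows "\<exists>\<eta>>0. \<forall>a b. \<bar>a\<bar> \<le> S \<longrightarrow> \<bar>tau a - tau b\<bar> \<le> \<eta> \<longrightarrow> \<bar>a - b\<bar> \<le> \<epsilon>"
proof (cases "S \<ge> 0")
  case True
  define h where "h a = min (tau (a + \<epsilon>) - tau a) (tau a - tau (a - \<epsilon>))" for a
  have "continuous_on {-S..S} h"
    unfolding h_def by (intro continuous_intros)
  then obtain a0 where a0: "\<forall>a\<in>{-S..S}. h a0 \<le> h a"
    using continuous_attains_inf[of "{-S..S}" h] True by auto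
  have pos: "h a0 > 0" using assms by (simp add: h_def)
  have "\<bar>a - b\<bar> \<le> \<epsilon>" if "\<bar>a\<bar> \<le> S" "\<bar>tau a - tau b\<bar> \<le> h a0 / 2" for a b
  proof (rule ccontr)
    assume "\<not> \<bar>a - b\<bar> \<le> \<epsilon>"
    then have "b > a + \<epsilon> \<or> b < a - \<epsilon>" by linarith
    then have "tau b > tau (a + \<epsilon>) \<or> tau b < tau (a - \<epsilon>)" by simp
    moreover have "h a0 \<le> h a" using a0 that(1) by (auto simp: abs_le_iff)
    ultimately show False using that pos unfolding h_def[of a] by linarith
  qed
  then show ?thesis using pos by (intro exI[of _ "h a0 / 2"]) auto
next
  case False
  then show ?thesis by (intro exI[of _ 1]) auto
qed

section \<open>Metric, measure and Lipschitz functions of one geometric data set\<close>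

locale geom_data =
  fixes X :: "'a gds"
  assumes gds: "geometric_data_set X"
begin

sublocale Metric_space "pts X" "feat_dist X"
  using gds by (simp add: geometric_data_set_def)

sublocale prob_space "gmeas X"
  using gds by (simp add: geometric_data_set_def)

lemma gds_topology_eq: "gds_topology X = mtopology"
  by (simp add: gds_topology_def)

lemma space_gmeas [simp]: "space (gmeas X) = pts X"
  using gds by (simp add: geometric_data_set_def)

lemma sets_gmeas: "sets (gmeas X) = sets (borel_of mtopology)"
  using gds by (simp add: geometric_data_set_def gds_topology_eq)

lemma pts_nonempty: "pts X \<noteq> {}"
  using not_empty by simp

lemma complete: mcomplete
  using gds by (simp add: geometric_data_set_def)

lemma ex_dense_seq: "\<exists>z. dense_seq (pts X) (feat_dist X) z"
  using gds pts_nonempty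
  by (intro separable_imp_dense_seq) (simp_all add: geometric_data_set_def gds_topology_eq)

lemma feats_nonempty: "feats X \<noteq> {}"
  using gds by (simp add: geometric_data_set_def)

lemma feats_extensional: "feats X \<subseteq> extensional (pts X)"
  using gds by (simp add: geometric_data_set_def)

lemma measure_open_pos: "openin mtopology U \<Longrightarrow> U \<noteq> {} \<Longrightarrow> prob U > 0"
  using gds by (simp add: geometric_data_set_def gds_topology_eq)

lemma mball_in_sets [measurable]: "mball x r \<in> sets (gmeas X)"
  by (simp add: sets_gmeas openin_imp_sets_borel_of)

lemma feats_lipschitz:
  assumes "f \<in> feats X" "x \<in> pts X" "y \<in> pts X"
  shows "\<bar>f x - f y\<bar> \<le> feat_dist X x y"
proof -
  have "bdd_above ((\<lambda>f. \<bar>f x - f y\<bar>) ` feats X)"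
    using gds assms by (simp add: geometric_data_set_def)
  then show ?thesis
    using assms cSUP_upper[of f "feats X" "\<lambda>f. \<bar>f x - f y\<bar>"] by (simp add: feat_dist_def)
qed

text \<open>The condition concerns values on \<open>pts X\<close> alone and does not demand
  extensionality, so it also covers functions such as the distance to a fixed point.\<close>

definition lipschitz :: "('a \<Rightarrow> real) \<Rightarrow> bool" where
  "lipschitz f \<longleftrightarrow> (\<forall>x\<in>pts X. \<forall>y\<in>pts X. \<bar>f x - f y\<bar> \<le> feat_dist X x y)"

lemma lipschitz_feats: "f \<in> feats X \<Longrightarrow> lipschitz f"
  using feats_lipschitz by (simp add: lipschitz_def)

lemma lipschitz_closure_of:
  assumes "F \<subseteq> extensional (pts X)" "\<And>f. f \<in> F \<Longrightarrow> lipschitz f"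
    and "u \<in> powertop_real (pts X) closure_of F"
  shows "lipschitz u"
  using closure_of_powertop_real_abs_diff_le[OF assms(1,3)] assms(2)
  by (simp add: lipschitz_def)

lemma lipschitz_closure_feats:
  "u \<in> powertop_real (pts X) closure_of feats X \<Longrightarrow> lipschitz u"
  using lipschitz_closure_of feats_extensional lipschitz_feats by blast

lemma lipschitz_tau: "lipschitz f \<Longrightarrow> lipschitz (compose (pts X) tau f)"
  unfolding lipschitz_def by (auto simp: compose_def intro: order_trans[OF tau_lipschitz])

lemma lipschitz_add_const: "lipschitz f \<Longrightarrow> lipschitz (restrict (\<lambda>x. f x + c) (pts X))"
  by (simp add: lipschitz_def)

lemma lipschitz_measurable:
  assumes f: "lipschitz f"
  shows "f \<in> borel_measurable (gmeas X)"
proof (rule borel_measurableI)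
  fix S :: "real set" assume S: "open S"
  have "openin mtopology (f -` S \<inter> pts X)"
    unfolding openin_mtopology
  proof (intro conjI allI impI)
    fix x assume x: "x \<in> f -` S \<inter> pts X"
    then obtain e where e: "e > 0" "ball (f x) e \<subseteq> S"
      using S by (auto simp: open_contains_ball)
    have "mball x e \<subseteq> f -` S \<inter> pts X"
    proof
      fix y assume y: "y \<in> mball x e"
      then have "\<bar>f x - f y\<bar> < e"
        using f x unfolding lipschitz_def by fastforce
      then have "f y \<in> ball (f x) e" by (simp add: dist_real_def)
      then show "y \<in> f -` S \<inter> pts X" using e y by auto
    qed
    then show "\<exists>r>0. mball x r \<subseteq> f -` S \<inter> pts X" using e by blast
  qed auto
  then show "f -` S \<inter> space (gmeas X) \<in> sets (gmeas X)"
    by (simp add: sets_gmeas openin_imp_sets_borel_of)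
qed

text \<open>Truncation at 1 provides an integrable majorant, so a pointwise convergent sequence
  converges in this integral. It is an ordinary L1 distance for the bounded functions in
  \<open>K_tau X\<close>, and by Markov's inequality it controls deviations in measure for unbounded
  features.\<close>

lemma closure_of_integral_approx:
  assumes F: "F \<subseteq> extensional (pts X)" and lip: "\<And>f. f \<in> F \<Longrightarrow> lipschitz f"
    and u: "u \<in> powertop_real (pts X) closure_of F" and e: "e > 0"
  shows "\<exists>f\<in>F. (LINT x|gmeas X. min 1 \<bar>f x - u x\<bar>) < e"
proof -
  obtain z where z: "dense_seq (pts X) (feat_dist X) z" using ex_dense_seq by blast
  obtain f where f: "\<And>n. f n \<in> F" "\<And>x. x \<in> pts X \<Longrightarrow> (\<lambda>n. f n x) \<longlonglongrightarrow> u x"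
    using closure_of_lipschitz_sequence[OF z F _ u] lip unfolding lipschitz_def by blast
  have [measurable]: "f n \<in> borel_measurable (gmeas X)" for n
    using f(1) lip lipschitz_measurable by blast
  have [measurable]: "u \<in> borel_measurable (gmeas X)"
    using lipschitz_closure_of[OF F lip u] lipschitz_measurable by blast
  have "(\<lambda>n. LINT x|gmeas X. min 1 \<bar>f n x - u x\<bar>) \<longlonglongrightarrow> (LINT x|gmeas X. 0)"
  proof (rule integral_dominated_convergence[where w = "\<lambda>_. 1"])
    show "AE x in gmeas X. (\<lambda>n. min 1 \<bar>f n x - u x\<bar>) \<longlonglongrightarrow> 0"
    proof (rule AE_I2)
      fix x assume "x \<in> space (gmeas X)"
      then have "(\<lambda>n. min 1 \<bar>f n x - u x\<bar>) \<longlonglongrightarrow> min 1 \<bar>u x - u x\<bar>"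
        by (intro tendsto_intros f(2)) auto
      then show "(\<lambda>n. min 1 \<bar>f n x - u x\<bar>) \<longlonglongrightarrow> 0" by simp
    qed
  qed auto
  then have "(\<lambda>n. LINT x|gmeas X. min 1 \<bar>f n x - u x\<bar>) \<longlonglongrightarrow> 0" by simp
  then have "eventually (\<lambda>n. (LINT x|gmeas X. min 1 \<bar>f n x - u x\<bar>) < e) sequentially"
    using e by (rule order_tendstoD(2))
  then show ?thesis using f(1) by (auto simp: eventually_sequentially)
qed

lemma K_tau_extensional: "(\<lambda>f. compose (pts X) tau f) ` feats X \<subseteq> extensional (pts X)"
  by (auto simp: compose_extensional)

lemma lipschitz_K_tau: "u \<in> K_tau X \<Longrightarrow> lipschitz u"
  unfolding K_tau_def
  by (erule lipschitz_closure_of[rotated 2]) (auto simp: K_tau_extensional lipschitz_tau lipschitz_feats)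

lemma abs_K_tau_le:
  assumes "u \<in> K_tau X" "x \<in> pts X"
  shows "\<bar>u x\<bar> \<le> 1/2"
proof (rule closure_of_powertop_real_abs_le[OF K_tau_extensional _ assms(2)])
  show "u \<in> powertop_real (pts X) closure_of (\<lambda>f. compose (pts X) tau f) ` feats X"
    using assms(1) by (simp add: K_tau_def)
  show "\<bar>f x\<bar> \<le> 1/2" if f: "f \<in> (\<lambda>f. compose (pts X) tau f) ` feats X" for f
  proof -
    obtain g where "f = compose (pts X) tau g" using f by blast
    then show ?thesis using abs_tau_le[of "g x"] assms(2) by (simp only: compose_eq)
  qed
qed

lemma tau_feats_in_K_tau: "f \<in> feats X \<Longrightarrow> compose (pts X) tau f \<in> K_tau X"
  unfolding K_tau_def using closure_of_powertop_real_superset[OF K_tau_extensional] by blast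

lemma K_tau_nonempty: "K_tau X \<noteq> {}"
  using tau_feats_in_K_tau feats_nonempty by blast

text \<open>Being 1-Lipschitz, tau preserves approximation at finitely many points. A translated
  feature may lie only in the closure of the features; its image under tau is nevertheless a
  legitimate element of \<open>K_tau X\<close>.\<close>

lemma tau_closure_in_K_tau:
  assumes "f \<in> powertop_real (pts X) closure_of feats X"
  shows "compose (pts X) tau f \<in> K_tau X"
  unfolding K_tau_def closure_of_powertop_real_iff[OF K_tau_extensional]
proof (intro conjI allI impI)
  fix I and e :: real assume I: "finite I \<and> I \<subseteq> pts X \<and> e > 0"
  then obtain g where g: "g \<in> feats X" "\<forall>i\<in>I. \<bar>g i - f i\<bar> < e"
    using assms unfolding closure_of_powertop_real_iff[OF feats_extensional] by blast
  have "\<bar>compose (pts X) tau g i - compose (pts X) tau f i\<bar> < e" if "i \<in> I" for i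
    using I g that tau_lipschitz[of "g i" "f i"] by (fastforce simp: compose_def)
  then show "\<exists>h\<in>(\<lambda>f. compose (pts X) tau f) ` feats X. \<forall>i\<in>I. \<bar>h i - compose (pts X) tau f i\<bar> < e"
    using g(1) by blast
qed (simp add: compose_extensional)

end

section \<open>The distances in terms of parameters\<close>

text \<open>The bounds 0 and \<open>C\<close> make every infimum and supremum of the definition a
  genuine one; over the reals they carry no information for unbounded sets.\<close>

lemma Hausdorff_dist_lessD:
  fixes D :: "'x \<Rightarrow> 'x \<Rightarrow> real"
  assumes D: "\<And>a b. a \<in> A \<Longrightarrow> b \<in> B \<Longrightarrow> 0 \<le> D a b \<and> D a b \<le> C"
    and ne: "A \<noteq> {}" "B \<noteq> {}" and less: "Hausdorff_dist D A B < r"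
  shows "a \<in> A \<Longrightarrow> \<exists>b\<in>B. D a b < r" and "b \<in> B \<Longrightarrow> \<exists>a\<in>A. D a b < r"
proof -
  have bdd1: "bdd_below ((\<lambda>b. D a b) ` B)" if "a \<in> A" for a
    using D that by (intro bdd_belowI[of _ 0]) auto
  have bdd2: "bdd_below ((\<lambda>a. D a b) ` A)" if "b \<in> B" for b
    using D that by (intro bdd_belowI[of _ 0]) auto
  obtain a0 b0 where ab: "a0 \<in> A" "b0 \<in> B" using ne by blast
  show "\<exists>b\<in>B. D a b < r" if a: "a \<in> A"
  proof -
    have "bdd_above ((\<lambda>a. INF b\<in>B. D a b) ` A)"
      using D ab bdd1 by (intro bdd_aboveI2[of _ _ C] cINF_lower2[of _ _ b0]) auto
    then have "(INF b\<in>B. D a b) \<le> (SUP a\<in>A. INF b\<in>B. D a b)"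
      using a by (intro cSUP_upper)
    also have "\<dots> < r" using less by (simp add: Hausdorff_dist_def)
    finally show ?thesis using cInf_lessD[of "D a ` B" r] ne by auto
  qed
  show "\<exists>a\<in>A. D a b < r" if b: "b \<in> B"
  proof -
    have "bdd_above ((\<lambda>b. INF a\<in>A. D a b) ` B)"
      using D ab bdd2 by (intro bdd_aboveI2[of _ _ C] cINF_lower2[of _ _ a0]) auto
    then have "(INF a\<in>A. D a b) \<le> (SUP b\<in>B. INF a\<in>A. D a b)"
      using b by (intro cSUP_upper)
    also have "\<dots> < r" using less by (simp add: Hausdorff_dist_def)
    finally show ?thesis using cInf_lessD[of "(\<lambda>a. D a b) ` A" r] ne by auto
  qed
qed

lemma Hausdorff_dist_leI:
  fixes D :: "'x \<Rightarrow> 'x \<Rightarrow> real"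
  assumes D: "\<And>a b. a \<in> A \<Longrightarrow> b \<in> B \<Longrightarrow> 0 \<le> D a b"
    and ne: "A \<noteq> {}" "B \<noteq> {}"
    and 1: "\<And>a. a \<in> A \<Longrightarrow> \<exists>b\<in>B. D a b \<le> r" and 2: "\<And>b. b \<in> B \<Longrightarrow> \<exists>a\<in>A. D a b \<le> r"
  shows "Hausdorff_dist D A B \<le> r"
  unfolding Hausdorff_dist_def
proof (intro max.boundedI cSUP_least ne)
  fix a assume a: "a \<in> A"
  then obtain b where "b \<in> B" "D a b \<le> r" using 1 by blast
  then show "(INF b\<in>B. D a b) \<le> r"
    using D a by (intro cINF_lower2[of _ _ b] bdd_belowI2[of _ 0]) auto
next
  fix b assume b: "b \<in> B"
  then obtain a where "a \<in> A" "D a b \<le> r" using 2 by blast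
  then show "(INF a\<in>A. D a b) \<le> r"
    using D b by (intro cINF_lower2[of _ _ a] bdd_belowI2[of _ 0]) auto
qed

lemma Hausdorff_dist_nonneg:
  fixes D :: "'x \<Rightarrow> 'x \<Rightarrow> real"
  assumes D: "\<And>a b. a \<in> A \<Longrightarrow> b \<in> B \<Longrightarrow> 0 \<le> D a b \<and> D a b \<le> C"
    and ne: "A \<noteq> {}" "B \<noteq> {}"
  shows "0 \<le> Hausdorff_dist D A B"
proof (rule ccontr)
  assume "\<not> ?thesis"
  then have "Hausdorff_dist D A B < 0" by simp
  moreover obtain a where "a \<in> A" using ne by blast
  ultimately obtain b where "b \<in> B" "D a b < 0"
    using Hausdorff_dist_lessD(1)[of A B D C 0 a] D ne by blast
  with D[OF \<open>a \<in> A\<close>] show False by force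
qed

lemma (in prob_space) KyFan_dist_bounds:
  "0 \<le> KyFan_dist M u v" "KyFan_dist M u v \<le> 1"
proof -
  let ?S = "{\<epsilon>. 0 \<le> \<epsilon> \<and> prob {z \<in> space M. \<bar>u z - v z\<bar> > \<epsilon>} \<le> \<epsilon>}"
  have 1: "1 \<in> ?S" by simp
  show "0 \<le> KyFan_dist M u v"
    unfolding KyFan_dist_def using 1 by (intro cInf_greatest) blast+
  show "KyFan_dist M u v \<le> 1"
    unfolding KyFan_dist_def using 1 by (intro cInf_lower) (auto intro!: bdd_belowI[of _ 0])
qed

lemma KyFan_dist_leI:
  assumes "0 \<le> e" "measure M {z \<in> space M. \<bar>u z - v z\<bar> > e} \<le> e"
  shows "KyFan_dist M u v \<le> e"
  unfolding KyFan_dist_def using assms by (intro cInf_lower) (auto intro!: bdd_belowI[of _ 0])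

lemma (in prob_space) KyFan_dist_lessD:
  assumes less: "KyFan_dist M u v < r"
    and [measurable]: "u \<in> borel_measurable M" "v \<in> borel_measurable M"
  shows "prob {z \<in> space M. \<bar>u z - v z\<bar> > r} \<le> r"
proof -
  have "1 \<in> {\<epsilon>. 0 \<le> \<epsilon> \<and> prob {z \<in> space M. \<bar>u z - v z\<bar> > \<epsilon>} \<le> \<epsilon>}" by simp
  then obtain e where e: "e < r" "prob {z \<in> space M. \<bar>u z - v z\<bar> > e} \<le> e"
    using cInf_lessD[OF _ less[unfolded KyFan_dist_def]] by blast
  have "prob {z \<in> space M. \<bar>u z - v z\<bar> > r} \<le> prob {z \<in> space M. \<bar>u z - v z\<bar> > e}"
    using e by (intro finite_measure_mono) auto
  with e show ?thesis by linarith
qed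

interpretation U: prob_space unit_lebesgue
  by (rule prob_space_unit_lebesgue)

lemma (in geom_data) lipschitz_parameter_measurable:
  assumes "lipschitz f" "\<phi> \<in> parameters (gmeas X)"
  shows "(\<lambda>w. f (\<phi> w)) \<in> borel_measurable unit_lebesgue"
  using lipschitz_measurable[OF assms(1)] assms(2) by (auto simp: parameters_def)

lemma (in geom_data) parameter_in_pts:
  assumes "\<phi> \<in> parameters (gmeas X)" "w \<in> {0..<1}"
  shows "\<phi> w \<in> pts X"
  using assms measurable_space[of \<phi> unit_lebesgue "gmeas X" w] by (auto simp: parameters_def)

text \<open>The coupling is replaced by a pair of maps on [0,1), the shape that
  \<open>d_conc\<close> already has. The condition lies between \<open>d_tau X Y < r\<close> and
  \<open>d_tau X Y \<le> r\<close>, by \<open>d_tau_lessD\<close> and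
  \<open>d_tau_leI\<close>.\<close>

definition tau_close :: "'a gds \<Rightarrow> 'b gds \<Rightarrow> real \<Rightarrow> bool" where
  "tau_close X Y r \<longleftrightarrow> (\<exists>\<phi>\<in>parameters (gmeas X). \<exists>\<psi>\<in>parameters (gmeas Y).
     (\<forall>u\<in>K_tau X. \<exists>v\<in>K_tau Y. (LINT w|unit_lebesgue. \<bar>u (\<phi> w) - v (\<psi> w)\<bar>) < r) \<and>
     (\<forall>v\<in>K_tau Y. \<exists>u\<in>K_tau X. (LINT w|unit_lebesgue. \<bar>u (\<phi> w) - v (\<psi> w)\<bar>) < r))"

text \<open>The Ky Fan condition at level r written out; it lies between the strict and the weak
  bound on \<open>d_conc\<close> for nonnegative r.\<close>

definition conc_close :: "'a gds \<Rightarrow> 'b gds \<Rightarrow> real \<Rightarrow> bool" where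
  "conc_close X Y r \<longleftrightarrow> (\<exists>\<phi>\<in>parameters (gmeas X). \<exists>\<psi>\<in>parameters (gmeas Y).
     (\<forall>f\<in>feats X. \<exists>g\<in>feats Y. measure unit_lebesgue {w\<in>{0..<1}. \<bar>f (\<phi> w) - g (\<psi> w)\<bar> > r} \<le> r) \<and>
     (\<forall>g\<in>feats Y. \<exists>f\<in>feats X. measure unit_lebesgue {w\<in>{0..<1}. \<bar>f (\<phi> w) - g (\<psi> w)\<bar> > r} \<le> r))"

lemma tau_close_sym: "tau_close X Y r \<Longrightarrow> tau_close Y X r"
  unfolding tau_close_def by (simp only: abs_minus_commute) blast

lemma conc_close_sym: "conc_close X Y r \<Longrightarrow> conc_close Y X r"
  unfolding conc_close_def by (simp only: abs_minus_commute) blast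

section \<open>Couplings as joint laws of parameters\<close>

lemma dense_seq_prod:
  assumes "Metric_space12 M1 d1 M2 d2" "dense_seq M1 d1 z" "dense_seq M2 d2 w"
  shows "dense_seq (M1 \<times> M2) (prod_dist d1 d2) (\<lambda>k. (z (fst (prod_decode k)), w (snd (prod_decode k))))"
proof -
  interpret Metric_space12 M1 d1 M2 d2 by fact
  have zM: "z i \<in> M1" "w j \<in> M2" for i j using assms(2,3) by (auto simp: dense_seq_def)
  show ?thesis
    unfolding dense_seq_def
  proof (intro conjI ballI allI impI)
    show "range (\<lambda>k. (z (fst (prod_decode k)), w (snd (prod_decode k)))) \<subseteq> M1 \<times> M2" using zM by auto
    fix p and e :: real assume p: "p \<in> M1 \<times> M2" "e > 0"
    obtain x y where xy: "p = (x,y)" "x \<in> M1" "y \<in> M2" using p by auto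
    obtain i where i: "d1 x (z i) < e/2"
      using assms(2) xy p(2) unfolding dense_seq_def by (metis half_gt_zero)
    obtain j where j: "d2 y (w j) < e/2"
      using assms(3) xy p(2) unfolding dense_seq_def by (metis half_gt_zero)
    have "prod_dist d1 d2 p (z i, w j) \<le> d1 x (z i) + d2 y (w j)"
      using prod_metric_le_components xy zM by auto
    then have "prod_dist d1 d2 p (z i, w j) < e" using i j by linarith
    then show "\<exists>k. prod_dist d1 d2 p (z (fst (prod_decode k)), w (snd (prod_decode k))) < e"
      by (intro exI[of _ "prod_encode (i,j)"]) simp
  qed
qed

locale geom_data_pair = X: geom_data X + Y: geom_data Y for X :: "'a gds" and Y :: "'b gds"
begin

sublocale XY: Metric_space12 "pts X" "feat_dist X" "pts Y" "feat_dist Y"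
  by unfold_locales

lemma prod_topology_eq:
  "prod_topology (gds_topology X) (gds_topology Y) = XY.Prod_metric.mtopology"
  by (simp add: XY.mtopology_prod_metric X.gds_topology_eq Y.gds_topology_eq)

lemma L1_bounds:
  assumes \<phi>: "\<phi> \<in> parameters (gmeas X)" and \<psi>: "\<psi> \<in> parameters (gmeas Y)"
    and u: "u \<in> K_tau X" and v: "v \<in> K_tau Y"
  shows "integrable unit_lebesgue (\<lambda>w. \<bar>u (\<phi> w) - v (\<psi> w)\<bar>)"
    and "0 \<le> (LINT w|unit_lebesgue. \<bar>u (\<phi> w) - v (\<psi> w)\<bar>)"
    and "(LINT w|unit_lebesgue. \<bar>u (\<phi> w) - v (\<psi> w)\<bar>) \<le> 1"
proof -
  have [measurable]: "(\<lambda>w. u (\<phi> w)) \<in> borel_measurable unit_lebesgue"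
      "(\<lambda>w. v (\<psi> w)) \<in> borel_measurable unit_lebesgue"
    using X.lipschitz_parameter_measurable[OF X.lipschitz_K_tau[OF u] \<phi>]
      Y.lipschitz_parameter_measurable[OF Y.lipschitz_K_tau[OF v] \<psi>] by auto
  have le: "\<bar>u (\<phi> w) - v (\<psi> w)\<bar> \<le> 1" if "w \<in> space unit_lebesgue" for w
    using X.abs_K_tau_le[OF u X.parameter_in_pts[OF \<phi>, of w]]
      Y.abs_K_tau_le[OF v Y.parameter_in_pts[OF \<psi>, of w]] that by auto
  show i: "integrable unit_lebesgue (\<lambda>w. \<bar>u (\<phi> w) - v (\<psi> w)\<bar>)"
    using le by (intro U.integrable_const_bound[of _ 1] AE_I2) auto
  show "0 \<le> (LINT w|unit_lebesgue. \<bar>u (\<phi> w) - v (\<psi> w)\<bar>)" by simp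
  show "(LINT w|unit_lebesgue. \<bar>u (\<phi> w) - v (\<psi> w)\<bar>) \<le> 1"
    using le by (intro U.integral_le_const i AE_I2)
qed

text \<open>The projections are continuous, hence measurable for the Borel structure of the product,
  and the L1 distance under the coupling becomes an integral over [0,1) by change of
  variables.\<close>

lemma coupling_parameters:
  assumes \<pi>: "\<pi> \<in> couplings X Y" and h: "h \<in> parameters \<pi>"
  shows "(\<lambda>w. fst (h w)) \<in> parameters (gmeas X)" "(\<lambda>w. snd (h w)) \<in> parameters (gmeas Y)"
    and "u \<in> K_tau X \<Longrightarrow> v \<in> K_tau Y \<Longrightarrow>
      L1_dist \<pi> (compose (pts X \<times> pts Y) u fst) (compose (pts X \<times> pts Y) v snd)
        = (LINT w|unit_lebesgue. \<bar>u (fst (h w)) - v (snd (h w))\<bar>)"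
proof -
  have sets: "sets \<pi> = sets (borel_of (prod_topology (gds_topology X) (gds_topology Y)))"
    and space: "space \<pi> = pts X \<times> pts Y"
    and d: "distr \<pi> (gmeas X) fst = gmeas X" "distr \<pi> (gmeas Y) snd = gmeas Y"
    using \<pi> by (auto simp: couplings_def)
  have fst: "fst \<in> \<pi> \<rightarrow>\<^sub>M gmeas X"
    using measurable_borel_of_continuous_map[OF continuous_map_fst[of "gds_topology X" "gds_topology Y"]]
    unfolding measurable_cong_sets[OF sets X.sets_gmeas] X.gds_topology_eq .
  have snd: "snd \<in> \<pi> \<rightarrow>\<^sub>M gmeas Y"
    using measurable_borel_of_continuous_map[OF continuous_map_snd[of "gds_topology X" "gds_topology Y"]]
    unfolding measurable_cong_sets[OF sets Y.sets_gmeas] Y.gds_topology_eq .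
  have h1: "h \<in> unit_lebesgue \<rightarrow>\<^sub>M \<pi>" and h2: "distr unit_lebesgue \<pi> h = \<pi>"
    using h by (auto simp: parameters_def)
  have "distr unit_lebesgue (gmeas X) (fst \<circ> h) = gmeas X"
    using distr_distr[OF fst h1] h2 d by simp
  then show "(\<lambda>w. fst (h w)) \<in> parameters (gmeas X)"
    using fst h1 by (auto simp: parameters_def comp_def)
  have "distr unit_lebesgue (gmeas Y) (snd \<circ> h) = gmeas Y"
    using distr_distr[OF snd h1] h2 d by simp
  then show "(\<lambda>w. snd (h w)) \<in> parameters (gmeas Y)"
    using snd h1 by (auto simp: parameters_def comp_def)
  assume u: "u \<in> K_tau X" and v: "v \<in> K_tau Y"
  have [measurable]: "u \<in> borel_measurable (gmeas X)" "v \<in> borel_measurable (gmeas Y)"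
    using X.lipschitz_measurable[OF X.lipschitz_K_tau[OF u]]
      Y.lipschitz_measurable[OF Y.lipschitz_K_tau[OF v]] by auto
  note [measurable] = fst snd
  have "L1_dist \<pi> (compose (pts X \<times> pts Y) u fst) (compose (pts X \<times> pts Y) v snd)
      = (LINT z|\<pi>. \<bar>u (fst z) - v (snd z)\<bar>)"
    unfolding L1_dist_def by (intro Bochner_Integration.integral_cong) (auto simp: space compose_def)
  also have "\<dots> = (LINT z|distr unit_lebesgue \<pi> h. \<bar>u (fst z) - v (snd z)\<bar>)"
    by (simp add: h2)
  also have "\<dots> = (LINT w|unit_lebesgue. \<bar>u (fst (h w)) - v (snd (h w))\<bar>)"
    by (rule integral_distr[OF h1]) measurable
  finally show "L1_dist \<pi> (compose (pts X \<times> pts Y) u fst) (compose (pts X \<times> pts Y) v snd)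
        = (LINT w|unit_lebesgue. \<bar>u (fst (h w)) - v (snd (h w))\<bar>)" .
qed

text \<open>The product of two complete separable spaces is again complete and separable, and a
  coupling is a Borel probability measure on it.\<close>

lemma coupling_has_parameter:
  assumes "\<pi> \<in> couplings X Y"
  shows "\<exists>h. h \<in> parameters \<pi>"
proof -
  obtain z w where "dense_seq (pts X) (feat_dist X) z" "dense_seq (pts Y) (feat_dist Y) w"
    using X.ex_dense_seq Y.ex_dense_seq by blast
  then have "parameters \<pi> \<noteq> {}"
    using assms X.complete Y.complete
    by (intro XY.Prod_metric.parameters_nonempty[OF _ dense_seq_prod[OF XY.Metric_space12_axioms]])
       (auto simp: XY.mcomplete_prod_metric couplings_def prod_topology_eq)
  then show ?thesis by blast
qed

lemma parameters_coupling:
  assumes \<phi>: "\<phi> \<in> parameters (gmeas X)" and \<psi>: "\<psi> \<in> parameters (gmeas Y)"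
  shows "\<exists>\<pi>\<in>couplings X Y. (\<lambda>w. (\<phi> w, \<psi> w)) \<in> parameters \<pi>"
proof -
  let ?B = "borel_of (prod_topology (gds_topology X) (gds_topology Y))"
  let ?h = "\<lambda>w. (\<phi> w, \<psi> w)"
  define \<pi> where "\<pi> = distr unit_lebesgue ?B ?h"
  obtain z w where zw: "dense_seq (pts X) (feat_dist X) z" "dense_seq (pts Y) (feat_dist Y) w"
    using X.ex_dense_seq Y.ex_dense_seq by blast
  have zM: "z i \<in> pts X" "w j \<in> pts Y" for i j using zw by (auto simp: dense_seq_def)
  have \<phi>': "\<phi> \<in> unit_lebesgue \<rightarrow>\<^sub>M gmeas X" "distr unit_lebesgue (gmeas X) \<phi> = gmeas X"
    and \<psi>': "\<psi> \<in> unit_lebesgue \<rightarrow>\<^sub>M gmeas Y" "distr unit_lebesgue (gmeas Y) \<psi> = gmeas Y"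
    using \<phi> \<psi> by (auto simp: parameters_def)
  have lipX: "X.lipschitz (\<lambda>x. feat_dist X (z i) x)" for i
    unfolding X.lipschitz_def using zM X.mdist_reverse_triangle X.commute
      by (metis)
  have lipY: "Y.lipschitz (\<lambda>x. feat_dist Y (w i) x)" for i
    unfolding Y.lipschitz_def using zM Y.mdist_reverse_triangle Y.commute
      by (metis)
  note [measurable] = X.lipschitz_parameter_measurable[OF lipX \<phi>] Y.lipschitz_parameter_measurable[OF lipY \<psi>]
  \<comment> \<open>The target carries the Borel sets of the product topology. The product metric is
    a root of the sum of the squared distances, so measurable distances to dense points in each
    factor suffice.\<close>
  have h: "?h \<in> unit_lebesgue \<rightarrow>\<^sub>M ?B"
    unfolding prod_topology_eq
  proof (rule XY.Prod_metric.measurable_borel_of_mtopologyI[OF dense_seq_prod[OF XY.Metric_space12_axioms zw]])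
    show "?h \<in> space unit_lebesgue \<rightarrow> pts X \<times> pts Y"
      using X.parameter_in_pts[OF \<phi>] Y.parameter_in_pts[OF \<psi>] by auto
  qed (simp add: prod_dist_def)
  have sets: "sets \<pi> = sets ?B" by (simp add: \<pi>_def)
  have space: "space \<pi> = pts X \<times> pts Y"
    by (simp add: \<pi>_def X.gds_topology_eq Y.gds_topology_eq)
  have fst: "fst \<in> ?B \<rightarrow>\<^sub>M gmeas X"
    using measurable_borel_of_continuous_map[OF continuous_map_fst[of "gds_topology X" "gds_topology Y"]]
    unfolding measurable_cong_sets[OF refl X.sets_gmeas] X.gds_topology_eq .
  have snd: "snd \<in> ?B \<rightarrow>\<^sub>M gmeas Y"
    using measurable_borel_of_continuous_map[OF continuous_map_snd[of "gds_topology X" "gds_topology Y"]]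
    unfolding measurable_cong_sets[OF refl Y.sets_gmeas] Y.gds_topology_eq .
  have "prob_space \<pi>" unfolding \<pi>_def using h by (rule U.prob_space_distr)
  moreover have "distr \<pi> (gmeas X) fst = gmeas X" "distr \<pi> (gmeas Y) snd = gmeas Y"
    using distr_distr[OF fst h] distr_distr[OF snd h] \<phi>' \<psi>' by (auto simp: \<pi>_def comp_def)
  ultimately have "\<pi> \<in> couplings X Y"
    using sets space by (simp add: couplings_def)
  moreover have "?h \<in> parameters \<pi>"
    using h measurable_cong_sets[OF refl sets, of unit_lebesgue] distr_cong[OF refl sets, of unit_lebesgue ?h ?h]
    by (simp add: parameters_def \<pi>_def)
  ultimately show ?thesis by blast
qed

lemma D_tau_bounds:
  assumes "\<pi> \<in> couplings X Y"
    and "a \<in> (\<lambda>u. compose (pts X \<times> pts Y) u fst) ` K_tau X"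
    and "b \<in> (\<lambda>v. compose (pts X \<times> pts Y) v snd) ` K_tau Y"
  shows "0 \<le> L1_dist \<pi> a b \<and> L1_dist \<pi> a b \<le> 1"
proof -
  obtain h where h: "h \<in> parameters \<pi>" using coupling_has_parameter[OF assms(1)] by blast
  show ?thesis
    using assms coupling_parameters[OF assms(1) h]
      L1_bounds[OF coupling_parameters(1,2)[OF assms(1) h]] by auto
qed

lemma D_tau_nonneg: "\<pi> \<in> couplings X Y \<Longrightarrow> 0 \<le> D_tau \<pi> X Y"
  unfolding D_tau_def
  by (rule Hausdorff_dist_nonneg[where C=1])
     (auto simp: X.K_tau_nonempty Y.K_tau_nonempty dest: D_tau_bounds)

lemma ex_parameters: "\<exists>\<phi>. \<phi> \<in> parameters (gmeas X)" "\<exists>\<psi>. \<psi> \<in> parameters (gmeas Y)"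
  using X.parameters_nonempty[OF X.complete _ X.prob_space_axioms X.sets_gmeas] X.ex_dense_seq
    Y.parameters_nonempty[OF Y.complete _ Y.prob_space_axioms Y.sets_gmeas] Y.ex_dense_seq by blast+

lemma couplings_nonempty: "couplings X Y \<noteq> {}"
  using ex_parameters parameters_coupling by blast

lemma d_tau_nonneg: "0 \<le> d_tau X Y"
  unfolding d_tau_def using couplings_nonempty by (intro cINF_greatest D_tau_nonneg)

lemma d_tau_lessD:
  assumes "d_tau X Y < r"
  shows "tau_close X Y r"
proof -
  obtain \<pi> where \<pi>: "\<pi> \<in> couplings X Y" "D_tau \<pi> X Y < r"
    using assms couplings_nonempty cInf_lessD[of "(\<lambda>\<pi>. D_tau \<pi> X Y) ` couplings X Y" r]
    by (auto simp: d_tau_def)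
  obtain h where h: "h \<in> parameters \<pi>" using coupling_has_parameter[OF \<pi>(1)] by blast
  note L = coupling_parameters(3)[OF \<pi>(1) h]
  note * = Hausdorff_dist_lessD[OF D_tau_bounds[OF \<pi>(1)] _ _ \<pi>(2)[unfolded D_tau_def]]
  have 1: "\<exists>v\<in>K_tau Y. (LINT w|unit_lebesgue. \<bar>u (fst (h w)) - v (snd (h w))\<bar>) < r" if "u \<in> K_tau X" for u
    using *(1)[of "compose (pts X \<times> pts Y) u fst"] that X.K_tau_nonempty Y.K_tau_nonempty by (auto simp: L)
  have 2: "\<exists>u\<in>K_tau X. (LINT w|unit_lebesgue. \<bar>u (fst (h w)) - v (snd (h w))\<bar>) < r" if "v \<in> K_tau Y" for v
    using *(2)[of "compose (pts X \<times> pts Y) v snd"] that X.K_tau_nonempty Y.K_tau_nonempty by (auto simp: L)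
  show ?thesis
    unfolding tau_close_def using coupling_parameters(1,2)[OF \<pi>(1) h] 1 2
    by (intro bexI[of _ "\<lambda>w. fst (h w)"] bexI[of _ "\<lambda>w. snd (h w)"]) auto
qed

lemma d_tau_leI:
  assumes "tau_close X Y r"
  shows "d_tau X Y \<le> r"
proof -
  obtain \<phi> \<psi> where \<phi>: "\<phi> \<in> parameters (gmeas X)" and \<psi>: "\<psi> \<in> parameters (gmeas Y)"
    and 1: "\<forall>u\<in>K_tau X. \<exists>v\<in>K_tau Y. (LINT w|unit_lebesgue. \<bar>u (\<phi> w) - v (\<psi> w)\<bar>) < r"
    and 2: "\<forall>v\<in>K_tau Y. \<exists>u\<in>K_tau X. (LINT w|unit_lebesgue. \<bar>u (\<phi> w) - v (\<psi> w)\<bar>) < r"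
    using assms by (auto simp: tau_close_def)
  obtain \<pi> where \<pi>: "\<pi> \<in> couplings X Y" and h: "(\<lambda>w. (\<phi> w, \<psi> w)) \<in> parameters \<pi>"
    using parameters_coupling[OF \<phi> \<psi>] by blast
  note L = coupling_parameters(3)[OF \<pi> h, simplified]
  have "D_tau \<pi> X Y \<le> r"
    unfolding D_tau_def
  proof (rule Hausdorff_dist_leI)
    show "\<exists>b\<in>(\<lambda>v. compose (pts X \<times> pts Y) v snd) ` K_tau Y. L1_dist \<pi> a b \<le> r"
      if "a \<in> (\<lambda>u. compose (pts X \<times> pts Y) u fst) ` K_tau X" for a
      using that 1 by (force simp: L)
    show "\<exists>a\<in>(\<lambda>u. compose (pts X \<times> pts Y) u fst) ` K_tau X. L1_dist \<pi> a b \<le> r"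
      if "b \<in> (\<lambda>v. compose (pts X \<times> pts Y) v snd) ` K_tau Y" for b
      using that 2 by (force simp: L)
  qed (use X.K_tau_nonempty Y.K_tau_nonempty D_tau_bounds[OF \<pi>] in auto)
  moreover have "d_tau X Y \<le> D_tau \<pi> X Y"
    unfolding d_tau_def using \<pi> D_tau_nonneg by (intro cINF_lower bdd_belowI2[of _ 0]) auto
  ultimately show ?thesis by linarith
qed

section \<open>Reduction of the observable distance to closeness of features along
  parameters\<close>

abbreviation HKF :: "(real \<Rightarrow> 'a) \<Rightarrow> (real \<Rightarrow> 'b) \<Rightarrow> real" where
  "HKF \<phi> \<psi> \<equiv> Hausdorff_dist (KyFan_dist unit_lebesgue)
       ((\<lambda>f. compose {0..<1} f \<phi>) ` feats X) ((\<lambda>g. compose {0..<1} g \<psi>) ` feats Y)"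

lemma HKF_nonneg: "0 \<le> HKF \<phi> \<psi>"
  using X.feats_nonempty Y.feats_nonempty U.KyFan_dist_bounds
  by (intro Hausdorff_dist_nonneg[where C=1]) auto

lemma d_conc_nonneg: "0 \<le> d_conc X Y"
  unfolding d_conc_def using ex_parameters HKF_nonneg by (intro cINF_greatest) auto

lemma d_conc_lessD:
  assumes "d_conc X Y < r"
  shows "conc_close X Y r"
proof -
  obtain \<phi> \<psi> where \<phi>: "\<phi> \<in> parameters (gmeas X)" and \<psi>: "\<psi> \<in> parameters (gmeas Y)" and less: "HKF \<phi> \<psi> < r"
    using cInf_lessD[of "(\<lambda>(\<phi>,\<psi>). HKF \<phi> \<psi>) ` (parameters (gmeas X) \<times> parameters (gmeas Y))" r]
      assms ex_parameters by (auto simp: d_conc_def)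
  have *: "measure unit_lebesgue {w\<in>{0..<1}. \<bar>f (\<phi> w) - g (\<psi> w)\<bar> > r} \<le> r"
    if "f \<in> feats X" "g \<in> feats Y" "KyFan_dist unit_lebesgue (compose {0..<1} f \<phi>) (compose {0..<1} g \<psi>) < r"
    for f g
  proof -
    have "compose {0..<1} f \<phi> \<in> borel_measurable unit_lebesgue"
      using X.lipschitz_parameter_measurable[OF X.lipschitz_feats[OF that(1)] \<phi>]
      by (subst measurable_cong[of _ _ "\<lambda>w. f (\<phi> w)"]) (auto simp: compose_def)
    moreover have "compose {0..<1} g \<psi> \<in> borel_measurable unit_lebesgue"
      using Y.lipschitz_parameter_measurable[OF Y.lipschitz_feats[OF that(2)] \<psi>]
      by (subst measurable_cong[of _ _ "\<lambda>w. g (\<psi> w)"]) (auto simp: compose_def)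
    ultimately have "measure unit_lebesgue {w\<in>space unit_lebesgue. \<bar>compose {0..<1} f \<phi> w - compose {0..<1} g \<psi> w\<bar> > r} \<le> r"
      using U.KyFan_dist_lessD[OF that(3)] by blast
    also have "{w\<in>space unit_lebesgue. \<bar>compose {0..<1} f \<phi> w - compose {0..<1} g \<psi> w\<bar> > r}
       = {w\<in>{0..<1}. \<bar>f (\<phi> w) - g (\<psi> w)\<bar> > r}"
      by (auto simp: compose_def)
    finally show ?thesis .
  qed
  note H = Hausdorff_dist_lessD[OF _ _ _ less, of 1]
  have 1: "\<exists>g\<in>feats Y. measure unit_lebesgue {w\<in>{0..<1}. \<bar>f (\<phi> w) - g (\<psi> w)\<bar> > r} \<le> r" if "f \<in> feats X" for f
    using H(1)[of "compose {0..<1} f \<phi>"] that *[of f] X.feats_nonempty Y.feats_nonempty U.KyFan_dist_bounds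
    by auto
  have 2: "\<exists>f\<in>feats X. measure unit_lebesgue {w\<in>{0..<1}. \<bar>f (\<phi> w) - g (\<psi> w)\<bar> > r} \<le> r" if "g \<in> feats Y" for g
    using H(2)[of "compose {0..<1} g \<psi>"] that *[of _ g] X.feats_nonempty Y.feats_nonempty U.KyFan_dist_bounds
    by auto
  show ?thesis unfolding conc_close_def using \<phi> \<psi> 1 2 by blast
qed

lemma d_conc_leI:
  assumes "conc_close X Y r" "0 \<le> r"
  shows "d_conc X Y \<le> r"
proof -
  obtain \<phi> \<psi> where \<phi>: "\<phi> \<in> parameters (gmeas X)" and \<psi>: "\<psi> \<in> parameters (gmeas Y)"
    and 1: "\<forall>f\<in>feats X. \<exists>g\<in>feats Y. measure unit_lebesgue {w\<in>{0..<1}. \<bar>f (\<phi> w) - g (\<psi> w)\<bar> > r} \<le> r"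
    and 2: "\<forall>g\<in>feats Y. \<exists>f\<in>feats X. measure unit_lebesgue {w\<in>{0..<1}. \<bar>f (\<phi> w) - g (\<psi> w)\<bar> > r} \<le> r"
    using assms by (auto simp: conc_close_def)
  have *: "KyFan_dist unit_lebesgue (compose {0..<1} f \<phi>) (compose {0..<1} g \<psi>) \<le> r"
    if "measure unit_lebesgue {w\<in>{0..<1}. \<bar>f (\<phi> w) - g (\<psi> w)\<bar> > r} \<le> r" for f g
  proof (rule KyFan_dist_leI[OF assms(2)])
    have "{w\<in>space unit_lebesgue. \<bar>compose {0..<1} f \<phi> w - compose {0..<1} g \<psi> w\<bar> > r}
       = {w\<in>{0..<1}. \<bar>f (\<phi> w) - g (\<psi> w)\<bar> > r}"
      by (auto simp: compose_def)
    with that show "measure unit_lebesgue {w\<in>space unit_lebesgue. \<bar>compose {0..<1} f \<phi> w - compose {0..<1} g \<psi> w\<bar> > r} \<le> r"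
      by simp
  qed
  have "HKF \<phi> \<psi> \<le> r"
  proof (rule Hausdorff_dist_leI)
    show "\<exists>b\<in>(\<lambda>g. compose {0..<1} g \<psi>) ` feats Y. KyFan_dist unit_lebesgue a b \<le> r"
      if "a \<in> (\<lambda>f. compose {0..<1} f \<phi>) ` feats X" for a
      using that 1 * by blast
    show "\<exists>a\<in>(\<lambda>f. compose {0..<1} f \<phi>) ` feats X. KyFan_dist unit_lebesgue a b \<le> r"
      if "b \<in> (\<lambda>g. compose {0..<1} g \<psi>) ` feats Y" for b
      using that 2 * by blast
  qed (use X.feats_nonempty Y.feats_nonempty U.KyFan_dist_bounds in auto)
  moreover have "d_conc X Y \<le> HKF \<phi> \<psi>"
    unfolding d_conc_def using \<phi> \<psi> HKF_nonneg
    by (intro cINF_lower2[of _ _ "(\<phi>,\<psi>)"] bdd_belowI2[of _ 0]) auto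
  ultimately show ?thesis by linarith
qed

end

section \<open>Comparison of the two notions of closeness\<close>

text \<open>Where the functions differ by at most e, the Lipschitz bound on tau contributes e; on
  the remaining set, of mass at most e, the integrand is at most 1.\<close>

lemma (in prob_space) integral_tau_diff_le:
  assumes [measurable]: "a \<in> borel_measurable M" "b \<in> borel_measurable M"
    and e: "0 \<le> e" and le: "prob {w \<in> space M. \<bar>a w - b w\<bar> > e} \<le> e"
  shows "(LINT w|M. \<bar>tau (a w) - tau (b w)\<bar>) \<le> 2 * e"
proof -
  let ?A = "{w \<in> space M. \<bar>a w - b w\<bar> > e}"
  have "(LINT w|M. \<bar>tau (a w) - tau (b w)\<bar>) \<le> (LINT w|M. e + indicator ?A w)"
  proof (rule integral_mono)
    show "integrable M (\<lambda>w. \<bar>tau (a w) - tau (b w)\<bar>)"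
      using abs_tau_diff_le_1 by (intro integrable_const_bound[of _ 1]) auto
    show "\<bar>tau (a w) - tau (b w)\<bar> \<le> e + indicator ?A w" if "w \<in> space M" for w
      using that tau_lipschitz[of "a w" "b w"] abs_tau_diff_le_1[of "a w" "b w"] e
      by (auto simp: indicator_def)
  qed (auto intro!: integrable_real_indicator simp: less_top[symmetric])
  also have "\<dots> = e + prob ?A"
    by (subst Bochner_Integration.integral_add) (auto simp: prob_space less_top[symmetric])
  finally show ?thesis using le by linarith
qed

text \<open>Markov's inequality; for e at most 1 the truncation does not affect the event.\<close>

lemma (in prob_space) prob_abs_diff_gt_le:
  assumes [measurable]: "a \<in> borel_measurable M" "b \<in> borel_measurable M"
    and e: "0 < e" "e \<le> 1"
  shows "prob {w \<in> space M. \<bar>a w - b w\<bar> > e} \<le> (LINT w|M. min 1 \<bar>a w - b w\<bar>) / e"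
proof -
  have "prob {w \<in> space M. \<bar>a w - b w\<bar> > e} \<le> prob {w \<in> space M. min 1 \<bar>a w - b w\<bar> \<ge> e}"
    using e by (intro finite_measure_mono) auto
  also have "\<dots> \<le> (LINT w|M. min 1 \<bar>a w - b w\<bar>) / e"
    using e by (intro integral_Markov_inequality_measure[where A="{}"] integrable_const_bound[of _ 1]) auto
  finally show ?thesis .
qed

text \<open>A level \<open>m\<close> of the upper half set within distance 1 of its infimum, so that
  \<open>m - 1\<close> falls below the infimum. The slack of 1 means that the infimum does not have
  to be attained.\<close>

lemma (in prob_space) ex_almost_median:
  fixes a :: "'a \<Rightarrow> real"
  assumes [measurable]: "a \<in> borel_measurable M"
  shows "\<exists>m. prob {w \<in> space M. a w \<le> m} \<ge> 1/2 \<and> prob {w \<in> space M. a w > m - 1} \<ge> 1/2"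
proof -
  interpret D: real_distribution "distr M borel a" by (rule real_distribution_distr) fact
  have cdf: "cdf (distr M borel a) t = prob {w \<in> space M. a w \<le> t}" for t
    by (simp add: cdf_def measure_distr vimage_def Int_def conj_commute)
  define S where "S = {t. prob {w \<in> space M. a w \<le> t} \<ge> 1/2}"
  have "eventually (\<lambda>t. cdf (distr M borel a) t > 1/2) at_top"
    using D.cdf_lim_at_top_prob by (rule order_tendstoD(1)) simp
  then obtain t where "cdf (distr M borel a) t > 1/2"
    by (meson eventually_happens trivial_limit_at_top_linorder)
  then have "t \<in> S" by (simp add: S_def cdf)
  then have "S \<noteq> {}" by blast
  have "eventually (\<lambda>t. cdf (distr M borel a) t < 1/2) at_bot"
    using D.cdf_lim_at_bot by (rule order_tendstoD(2)) simp
  then obtain t0 where t0: "\<And>t. t \<le> t0 \<Longrightarrow> cdf (distr M borel a) t < 1/2"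
    by (auto simp: eventually_at_bot_linorder)
  have bdd: "bdd_below S"
  proof (rule bdd_belowI)
    show "t0 \<le> t" if "t \<in> S" for t
      using t0[of t] that unfolding S_def cdf by force
  qed
  obtain m where m: "m \<in> S" "m < Inf S + 1"
    using cInf_lessD[OF \<open>S \<noteq> {}\<close>, of "Inf S + 1"] by auto
  then have "m - 1 \<notin> S" using cInf_lower[OF _ bdd, of "m - 1"] by linarith
  then have "prob {w \<in> space M. a w \<le> m - 1} < 1/2" by (simp add: S_def)
  moreover have "prob {w \<in> space M. a w > m - 1} = 1 - prob {w \<in> space M. a w \<le> m - 1}"
    by (subst prob_compl[symmetric]) (auto intro!: arg_cong[where f=prob])
  ultimately show ?thesis using m(1) by (intro exI[of _ m]) (auto simp: S_def)
qed

lemma (in prob_space) ex_mem_Int3: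
  assumes "A \<in> events" "B \<in> events" "C \<in> events" "prob A + prob B + prob C > 2"
  shows "\<exists>w. w \<in> A \<and> w \<in> B \<and> w \<in> C"
proof (rule ccontr)
  assume "\<not> ?thesis"
  then have "space M \<subseteq> (space M - A) \<union> (space M - B) \<union> (space M - C)" by blast
  then have "prob (space M) \<le> prob ((space M - A) \<union> (space M - B) \<union> (space M - C))"
    using assms by (intro finite_measure_mono) auto
  also have "\<dots> \<le> prob (space M - A) + prob (space M - B) + prob (space M - C)"
    using assms measure_Un_le[of "(space M - A) \<union> (space M - B)" M "space M - C"]
      measure_Un_le[of "space M - A" M "space M - B"] by auto
  finally show False using assms by (simp add: prob_space prob_compl)
qed

text \<open>With features 1-Lipschitz by construction of \<open>feat_dist\<close>, this says that
  their closure consists of exactly all 1-Lipschitz functions. It is the trait of mm-spaces that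
  isomorphisms preserve, and it supplies translates of features up to closure.\<close>

definition lip_saturated :: "'a gds \<Rightarrow> bool" where
  "lip_saturated X \<longleftrightarrow> (\<forall>f\<in>extensional (pts X).
     (\<forall>x\<in>pts X. \<forall>y\<in>pts X. \<bar>f x - f y\<bar> \<le> feat_dist X x y) \<longrightarrow>
     f \<in> powertop_real (pts X) closure_of feats X)"

context geom_data
begin

lemma lip_saturatedD:
  "lip_saturated X \<Longrightarrow> f \<in> extensional (pts X) \<Longrightarrow> lipschitz f \<Longrightarrow>
    f \<in> powertop_real (pts X) closure_of feats X"
  by (simp add: lip_saturated_def lipschitz_def)

lemma integral_parameter:
  assumes "\<phi> \<in> parameters (gmeas X)" "h \<in> borel_measurable (gmeas X)"
  shows "(LINT w|unit_lebesgue. h (\<phi> w)) = (LINT x|gmeas X. h x :: real)"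
  using integral_distr[of \<phi> unit_lebesgue "gmeas X" h] assms by (simp add: parameters_def)

lemma prob_parameter:
  assumes "\<phi> \<in> parameters (gmeas X)" "A \<in> sets (gmeas X)"
  shows "measure unit_lebesgue {w \<in> {0..<1}. \<phi> w \<in> A} = prob A"
  using measure_distr[of \<phi> unit_lebesgue "gmeas X" A] assms
  by (simp add: parameters_def vimage_def Int_def conj_commute)

text \<open>Both functions take values of absolute value at most 1/2, so the truncation in
  \<open>closure_of_integral_approx\<close> disappears.\<close>

lemma K_tau_approx:
  assumes \<phi>: "\<phi> \<in> parameters (gmeas X)" and u: "u \<in> K_tau X" and e: "e > 0"
  shows "\<exists>f\<in>feats X. (LINT w|unit_lebesgue. \<bar>tau (f (\<phi> w)) - u (\<phi> w)\<bar>) < e"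
proof -
  obtain f where f: "f \<in> feats X" and less: "(LINT x|gmeas X. min 1 \<bar>compose (pts X) tau f x - u x\<bar>) < e"
    using closure_of_integral_approx[OF K_tau_extensional _ u[unfolded K_tau_def] e] lipschitz_tau[OF lipschitz_feats]
    by auto
  have [measurable]: "f \<in> borel_measurable (gmeas X)" "u \<in> borel_measurable (gmeas X)"
    using f u by (simp_all add: lipschitz_measurable lipschitz_feats lipschitz_K_tau)
  have "\<bar>tau (f x) - u x\<bar> \<le> 1" if "x \<in> pts X" for x
    using abs_tau_le[of "f x"] abs_K_tau_le[OF u that] by linarith
  then have "(LINT x|gmeas X. min 1 \<bar>compose (pts X) tau f x - u x\<bar>) = (LINT x|gmeas X. \<bar>tau (f x) - u x\<bar>)"
    by (intro Bochner_Integration.integral_cong) (auto simp: compose_def)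
  also have "\<dots> = (LINT w|unit_lebesgue. \<bar>tau (f (\<phi> w)) - u (\<phi> w)\<bar>)"
    by (rule integral_parameter[symmetric, OF \<phi>]) measurable
  finally show ?thesis using f less by auto
qed

lemma closure_feats_approx:
  assumes \<phi>: "\<phi> \<in> parameters (gmeas X)" and u: "u \<in> powertop_real (pts X) closure_of feats X"
    and e: "0 < e" "e \<le> 1"
  shows "\<exists>f\<in>feats X. measure unit_lebesgue {w \<in> {0..<1}. \<bar>f (\<phi> w) - u (\<phi> w)\<bar> > e} \<le> e"
proof -
  \<comment> \<open>Tolerance \<open>e * e\<close>, since Markov's inequality at level e divides by
    e.\<close>
  obtain f where f: "f \<in> feats X" and less: "(LINT x|gmeas X. min 1 \<bar>f x - u x\<bar>) < e * e"
    using closure_of_integral_approx[OF feats_extensional lipschitz_feats u, of "e * e"] e by auto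
  have lip: "lipschitz f" "lipschitz u"
    using f u by (simp_all add: lipschitz_feats lipschitz_closure_feats)
  note [measurable] = lipschitz_measurable[OF lip(1)] lipschitz_measurable[OF lip(2)]
  have "measure unit_lebesgue {w \<in> {0..<1}. \<bar>f (\<phi> w) - u (\<phi> w)\<bar> > e}
      \<le> (LINT w|unit_lebesgue. min 1 \<bar>f (\<phi> w) - u (\<phi> w)\<bar>) / e"
    using U.prob_abs_diff_gt_le[OF lipschitz_parameter_measurable[OF lip(1) \<phi>]
        lipschitz_parameter_measurable[OF lip(2) \<phi>] e] by simp
  also have "(LINT w|unit_lebesgue. min 1 \<bar>f (\<phi> w) - u (\<phi> w)\<bar>) = (LINT x|gmeas X. min 1 \<bar>f x - u x\<bar>)"
    by (rule integral_parameter[OF \<phi>, of "\<lambda>x. min 1 \<bar>f x - u x\<bar>"]) measurable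
  also have "\<dots> / e \<le> e" using less e by (simp add: field_simps)
  finally show ?thesis using f by blast
qed

text \<open>The balls of integer radius increase to the whole space; continuity of the measure from
  below.\<close>

lemma ex_ball_prob_ge:
  assumes x: "x \<in> pts X" and e: "e > 0"
  shows "\<exists>R\<ge>0. prob (mball x R) \<ge> 1 - e"
proof -
  have "(\<lambda>n. prob (mball x (real n))) \<longlonglongrightarrow> prob (\<Union>n. mball x (real n))"
    by (rule finite_Lim_measure_incseq) (auto simp: incseq_def)
  also have "(\<Union>n. mball x (real n)) = space (gmeas X)"
    using x reals_Archimedean2 by auto
  finally have "(\<lambda>n. prob (mball x (real n))) \<longlonglongrightarrow> 1"
    by (simp only: prob_space)
  then have "eventually (\<lambda>n. prob (mball x (real n)) > 1 - e) sequentially"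
    by (rule order_tendstoD(1)) (use e in simp)
  then obtain n where "prob (mball x (real n)) > 1 - e"
    by (auto simp: eventually_sequentially)
  then show ?thesis by (intro exI[of _ "real n"]) auto
qed

end

section \<open>Transfer of closeness between features and their images under tau\<close>

context geom_data_pair
begin

text \<open>The factor 3 consists of one e for replacing \<open>u\<close> by tau of a feature and 2e
  for replacing that feature by its partner on \<open>Y\<close>.\<close>

lemma K_tau_half_close:
  assumes \<phi>: "\<phi> \<in> parameters (gmeas X)" and \<psi>: "\<psi> \<in> parameters (gmeas Y)" and e: "e > 0"
    and H: "\<forall>f\<in>feats X. \<exists>g\<in>feats Y. measure unit_lebesgue {w\<in>{0..<1}. \<bar>f (\<phi> w) - g (\<psi> w)\<bar> > e} \<le> e"
    and u: "u \<in> K_tau X"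
  shows "\<exists>v\<in>K_tau Y. (LINT w|unit_lebesgue. \<bar>u (\<phi> w) - v (\<psi> w)\<bar>) < 3 * e"
proof -
  obtain f where f: "f \<in> feats X" and fu: "(LINT w|unit_lebesgue. \<bar>tau (f (\<phi> w)) - u (\<phi> w)\<bar>) < e"
    using X.K_tau_approx[OF \<phi> u e] by blast
  obtain g where g: "g \<in> feats Y"
    and fg: "measure unit_lebesgue {w\<in>{0..<1}. \<bar>f (\<phi> w) - g (\<psi> w)\<bar> > e} \<le> e"
    using H f by blast
  let ?v = "compose (pts Y) tau g"
  have v: "?v \<in> K_tau Y" using g by (rule Y.tau_feats_in_K_tau)
  have [measurable]: "(\<lambda>w. f (\<phi> w)) \<in> borel_measurable unit_lebesgue"
      "(\<lambda>w. g (\<psi> w)) \<in> borel_measurable unit_lebesgue" "(\<lambda>w. u (\<phi> w)) \<in> borel_measurable unit_lebesgue"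
    using f g u \<phi> \<psi> by (simp_all add: X.lipschitz_parameter_measurable Y.lipschitz_parameter_measurable
        X.lipschitz_feats Y.lipschitz_feats X.lipschitz_K_tau)
  have veq: "?v (\<psi> w) = tau (g (\<psi> w))" if "w \<in> {0..<1}" for w
    using Y.parameter_in_pts[OF \<psi> that] by (simp add: compose_def)
  have i1: "integrable unit_lebesgue (\<lambda>w. \<bar>tau (f (\<phi> w)) - u (\<phi> w)\<bar>)"
  proof (intro U.integrable_const_bound[of _ 1] AE_I2)
    fix w assume "w \<in> space unit_lebesgue"
    then show "norm \<bar>tau (f (\<phi> w)) - u (\<phi> w)\<bar> \<le> 1"
      using abs_tau_le[of "f (\<phi> w)"] X.abs_K_tau_le[OF u X.parameter_in_pts[OF \<phi>, of w]] by auto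
  qed measurable
  have i2: "integrable unit_lebesgue (\<lambda>w. \<bar>tau (f (\<phi> w)) - tau (g (\<psi> w))\<bar>)"
    using abs_tau_diff_le_1 by (intro U.integrable_const_bound[of _ 1]) auto
  have "(LINT w|unit_lebesgue. \<bar>u (\<phi> w) - ?v (\<psi> w)\<bar>)
      \<le> (LINT w|unit_lebesgue. \<bar>tau (f (\<phi> w)) - u (\<phi> w)\<bar> + \<bar>tau (f (\<phi> w)) - tau (g (\<psi> w))\<bar>)"
    using L1_bounds(1)[OF \<phi> \<psi> u v] i1 i2 by (intro integral_mono) (auto simp: veq)
  also have "\<dots> = (LINT w|unit_lebesgue. \<bar>tau (f (\<phi> w)) - u (\<phi> w)\<bar>)
      + (LINT w|unit_lebesgue. \<bar>tau (f (\<phi> w)) - tau (g (\<psi> w))\<bar>)"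
    using i1 i2 by (rule Bochner_Integration.integral_add)
  also have "\<dots> < 3 * e"
    using fu U.integral_tau_diff_le[of "\<lambda>w. f (\<phi> w)" "\<lambda>w. g (\<psi> w)" e] fg e by simp
  finally show ?thesis using v by blast
qed

text \<open>A feature of moderate size at the base point stays of moderate size on a ball carrying most of
  the mass, and there \<open>tau\<close> is uniformly invertible.\<close>

lemma tau_close_imp_prob_le:
  assumes \<phi>: "\<phi> \<in> parameters (gmeas X)" and \<psi>: "\<psi> \<in> parameters (gmeas Y)"
    and f: "X.lipschitz f" and g: "Y.lipschitz g"
    and x: "x \<in> pts X" and fx: "\<bar>f x\<bar> \<le> S"
    and R: "X.prob (X.mball x R) \<ge> 1 - e/2"
    and eta: "\<eta> > 0" "\<forall>a b. \<bar>a\<bar> \<le> S + R \<longrightarrow> \<bar>tau a - tau b\<bar> \<le> \<eta> \<longrightarrow> \<bar>a - b\<bar> \<le> e"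
    and less: "(LINT w|unit_lebesgue. \<bar>tau (f (\<phi> w)) - tau (g (\<psi> w))\<bar>) \<le> \<eta> * (e/2)"
  shows "measure unit_lebesgue {w\<in>{0..<1}. \<bar>f (\<phi> w) - g (\<psi> w)\<bar> > e} \<le> e"
proof -
  note [measurable] = X.lipschitz_parameter_measurable[OF f \<phi>] Y.lipschitz_parameter_measurable[OF g \<psi>]
  have ph [measurable]: "\<phi> \<in> unit_lebesgue \<rightarrow>\<^sub>M gmeas X" using \<phi> by (simp add: parameters_def)
  let ?A = "{w\<in>space unit_lebesgue. \<phi> w \<in> X.mball x R}"
  let ?B = "{w\<in>space unit_lebesgue. \<bar>tau (f (\<phi> w)) - tau (g (\<psi> w))\<bar> \<ge> \<eta>}"
  have A [measurable]: "?A \<in> sets unit_lebesgue" using measurable_sets[OF ph X.mball_in_sets[of x R]]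
    by (simp only: vimage_def Int_def mem_Collect_eq conj_commute)
  have B [measurable]: "?B \<in> sets unit_lebesgue" by measurable
  \<comment> \<open>A bad parameter value either leaves the large ball or has tau-values at least
    \<eta> apart. Each event has mass at most e/2, by the choice of \<open>R\<close> and by Markov's
    inequality respectively.\<close>
  have "{w\<in>{0..<1}. \<bar>f (\<phi> w) - g (\<psi> w)\<bar> > e} \<subseteq> (space unit_lebesgue - ?A) \<union> ?B"
  proof (rule subsetI, rule ccontr)
    fix w assume w: "w \<in> {w\<in>{0..<1}. \<bar>f (\<phi> w) - g (\<psi> w)\<bar> > e}"
      and n: "w \<notin> (space unit_lebesgue - ?A) \<union> ?B"
    have ball: "\<phi> w \<in> X.mball x R" using n w by auto
    then have "\<bar>f x - f (\<phi> w)\<bar> \<le> feat_dist X x (\<phi> w)" using f x unfolding X.lipschitz_def by auto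
    moreover have "feat_dist X x (\<phi> w) < R" using ball by simp
    ultimately have "\<bar>f (\<phi> w)\<bar> \<le> S + R" using fx by linarith
    moreover have "\<bar>tau (f (\<phi> w)) - tau (g (\<psi> w))\<bar> \<le> \<eta>" using n w by auto
    ultimately have "\<bar>f (\<phi> w) - g (\<psi> w)\<bar> \<le> e" using eta by blast
    with w show False by simp
  qed
  then have "measure unit_lebesgue {w\<in>{0..<1}. \<bar>f (\<phi> w) - g (\<psi> w)\<bar> > e}
      \<le> measure unit_lebesgue ((space unit_lebesgue - ?A) \<union> ?B)"
    by (rule U.finite_measure_mono) (intro sets.Un sets.compl_sets A B)
  also have "\<dots> \<le> U.prob (space unit_lebesgue - ?A) + U.prob ?B"
    by (intro measure_Un_le sets.compl_sets A B)
  also have "U.prob (space unit_lebesgue - ?A) \<le> e/2"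
    using X.prob_parameter[OF \<phi>, of "X.mball x R"] R A by (subst U.prob_compl) auto
  also have "U.prob ?B \<le> (LINT w|unit_lebesgue. \<bar>tau (f (\<phi> w)) - tau (g (\<psi> w))\<bar>) / \<eta>"
    using eta(1) abs_tau_diff_le_1
    by (intro integral_Markov_inequality_measure[where A="{}"] U.integrable_const_bound[of _ 1]) auto
  also have "\<dots> \<le> e/2" using less eta(1) by (simp add: field_simps)
  finally show ?thesis by simp
qed

lemma integral_tau_triangle:
  assumes \<phi>: "\<phi> \<in> parameters (gmeas X)" and \<psi>: "\<psi> \<in> parameters (gmeas Y)"
    and f: "X.lipschitz f" and v: "v \<in> K_tau Y" and g: "Y.lipschitz g"
    and 1: "(LINT w|unit_lebesgue. \<bar>tau (f (\<phi> w)) - v (\<psi> w)\<bar>) \<le> a"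
    and 2: "(LINT w|unit_lebesgue. \<bar>tau (g (\<psi> w)) - v (\<psi> w)\<bar>) \<le> b"
  shows "(LINT w|unit_lebesgue. \<bar>tau (f (\<phi> w)) - tau (g (\<psi> w))\<bar>) \<le> a + b"
proof -
  note [measurable] = X.lipschitz_parameter_measurable[OF f \<phi>] Y.lipschitz_parameter_measurable[OF g \<psi>]
    Y.lipschitz_parameter_measurable[OF Y.lipschitz_K_tau[OF v] \<psi>]
  have vb: "\<bar>v (\<psi> w)\<bar> \<le> 1/2" if "w \<in> space unit_lebesgue" for w
    using Y.abs_K_tau_le[OF v Y.parameter_in_pts[OF \<psi>, of w]] that by simp
  have i: "integrable unit_lebesgue (\<lambda>w. \<bar>tau (h w) - v (\<psi> w)\<bar>)"
    if [measurable]: "h \<in> borel_measurable unit_lebesgue" for h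
  proof (intro U.integrable_const_bound[of _ 1] AE_I2)
    fix w assume "w \<in> space unit_lebesgue"
    then show "norm \<bar>tau (h w) - v (\<psi> w)\<bar> \<le> 1"
      using abs_tau_le[of "h w"] vb[of w] by auto
  qed measurable
  have "(LINT w|unit_lebesgue. \<bar>tau (f (\<phi> w)) - tau (g (\<psi> w))\<bar>)
    \<le> (LINT w|unit_lebesgue. \<bar>tau (f (\<phi> w)) - v (\<psi> w)\<bar> + \<bar>tau (g (\<psi> w)) - v (\<psi> w)\<bar>)"
    using abs_tau_diff_le_1
    by (intro integral_mono Bochner_Integration.integrable_add i U.integrable_const_bound[of _ 1]) auto
  also have "\<dots> = (LINT w|unit_lebesgue. \<bar>tau (f (\<phi> w)) - v (\<psi> w)\<bar>)
      + (LINT w|unit_lebesgue. \<bar>tau (g (\<psi> w)) - v (\<psi> w)\<bar>)"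
    by (intro Bochner_Integration.integral_add i) auto
  finally show ?thesis using 1 2 by linarith
qed

text \<open>Saturation puts the translate of \<open>g\<close> only into the closure of the features;
  approximating it by a feature costs a second e. This undoes the normalisation after the
  comparison.\<close>

lemma ex_close_translated_feature:
  assumes sat: "lip_saturated Y"
    and \<phi>: "\<phi> \<in> parameters (gmeas X)" and \<psi>: "\<psi> \<in> parameters (gmeas Y)"
    and f: "X.lipschitz f" and g: "Y.lipschitz g"
    and e: "0 < e" "e \<le> 1"
    and le: "measure unit_lebesgue {w\<in>{0..<1}. \<bar>f (\<phi> w) - g (\<psi> w)\<bar> > e} \<le> e"
  shows "\<exists>g'\<in>feats Y. measure unit_lebesgue {w\<in>{0..<1}. \<bar>(f (\<phi> w) + c) - g' (\<psi> w)\<bar> > 2 * e} \<le> 2 * e"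
proof -
  define u where "u = restrict (\<lambda>y. g y + c) (pts Y)"
  have u: "u (\<psi> w) = g (\<psi> w) + c" if "w \<in> {0..<1}" for w
    using Y.parameter_in_pts[OF \<psi> that] by (simp add: u_def)
  have lu: "Y.lipschitz u" unfolding u_def using g by (rule Y.lipschitz_add_const)
  then have "u \<in> powertop_real (pts Y) closure_of feats Y"
    by (intro Y.lip_saturatedD[OF sat]) (auto simp: u_def)
  then obtain g' where g': "g' \<in> feats Y"
    and le': "measure unit_lebesgue {w \<in> {0..<1}. \<bar>g' (\<psi> w) - u (\<psi> w)\<bar> > e} \<le> e"
    using Y.closure_feats_approx[OF \<psi> _ e] by blast
  note [measurable] = X.lipschitz_parameter_measurable[OF f \<phi>] Y.lipschitz_parameter_measurable[OF g \<psi>]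
    Y.lipschitz_parameter_measurable[OF lu \<psi>]
    Y.lipschitz_parameter_measurable[OF Y.lipschitz_feats[OF g'] \<psi>]
  have meas: "{w\<in>{0..<1}. \<bar>a w - b w\<bar> > e} \<in> sets unit_lebesgue"
    if [measurable]: "a \<in> borel_measurable unit_lebesgue" "b \<in> borel_measurable unit_lebesgue" for a b
  proof -
    have "{w\<in>space unit_lebesgue. \<bar>a w - b w\<bar> > e} \<in> sets unit_lebesgue" by measurable
    then show ?thesis by simp
  qed
  have "{w\<in>{0..<1}. \<bar>(f (\<phi> w) + c) - g' (\<psi> w)\<bar> > 2 * e}
      \<subseteq> {w\<in>{0..<1}. \<bar>f (\<phi> w) - g (\<psi> w)\<bar> > e} \<union> {w \<in> {0..<1}. \<bar>g' (\<psi> w) - u (\<psi> w)\<bar> > e}"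
    by (auto simp: u)
  then have "measure unit_lebesgue {w\<in>{0..<1}. \<bar>(f (\<phi> w) + c) - g' (\<psi> w)\<bar> > 2 * e} \<le>
      measure unit_lebesgue ({w\<in>{0..<1}. \<bar>f (\<phi> w) - g (\<psi> w)\<bar> > e} \<union> {w \<in> {0..<1}. \<bar>g' (\<psi> w) - u (\<psi> w)\<bar> > e})"
    by (rule U.finite_measure_mono) (intro sets.Un meas; measurable)
  also have "\<dots> \<le> measure unit_lebesgue {w\<in>{0..<1}. \<bar>f (\<phi> w) - g (\<psi> w)\<bar> > e}
      + measure unit_lebesgue {w \<in> {0..<1}. \<bar>g' (\<psi> w) - u (\<psi> w)\<bar> > e}"
    by (intro measure_Un_le meas) auto
  finally show ?thesis using le le' g' by (intro bexI[of _ g']) auto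
qed

end

context geom_data_pair
begin

sublocale YX: geom_data_pair Y X
  by unfold_locales

text \<open>Subtracting \<open>f x\<close> makes the feature vanish at the base point, so it is
  bounded by \<open>R\<close> on the ball and tau can be inverted there; the constant is restored on
  \<open>Y\<close> at the end. Leaving \<open>S\<close> free lets this direction share its \<eta>
  with the opposite one, where \<open>R + 2\<close> is needed.\<close>

lemma feats_half_close_from_base:
  assumes sat: "lip_saturated X" "lip_saturated Y"
    and \<phi>: "\<phi> \<in> parameters (gmeas X)" and \<psi>: "\<psi> \<in> parameters (gmeas Y)"
    and e: "0 < e" "e \<le> 1"
    and x: "x \<in> pts X" and S: "0 \<le> S"
    and R: "X.prob (X.mball x R) \<ge> 1 - e/2"
    and eta: "\<eta> > 0" "\<forall>a b. \<bar>a\<bar> \<le> S + R \<longrightarrow> \<bar>tau a - tau b\<bar> \<le> \<eta> \<longrightarrow> \<bar>a - b\<bar> \<le> e"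
    and H: "\<forall>u\<in>K_tau X. \<exists>v\<in>K_tau Y. (LINT w|unit_lebesgue. \<bar>u (\<phi> w) - v (\<psi> w)\<bar>) < \<eta> * e / 4"
    and f: "f \<in> feats X"
  shows "\<exists>g\<in>feats Y. measure unit_lebesgue {w\<in>{0..<1}. \<bar>f (\<phi> w) - g (\<psi> w)\<bar> > 2 * e} \<le> 2 * e"
proof -
  define f0 where "f0 = restrict (\<lambda>y. f y + - f x) (pts X)"
  have lip: "X.lipschitz f0" unfolding f0_def using X.lipschitz_feats[OF f] by (rule X.lipschitz_add_const)
  have "f0 \<in> powertop_real (pts X) closure_of feats X"
    using lip by (intro X.lip_saturatedD[OF sat(1)]) (auto simp: f0_def)
  then obtain v where v: "v \<in> K_tau Y"
    and 1: "(LINT w|unit_lebesgue. \<bar>compose (pts X) tau f0 (\<phi> w) - v (\<psi> w)\<bar>) < \<eta> * e / 4"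
    using H X.tau_closure_in_K_tau by blast
  have "(LINT w|unit_lebesgue. \<bar>compose (pts X) tau f0 (\<phi> w) - v (\<psi> w)\<bar>)
      = (LINT w|unit_lebesgue. \<bar>tau (f0 (\<phi> w)) - v (\<psi> w)\<bar>)"
    using X.parameter_in_pts[OF \<phi>]
    by (intro Bochner_Integration.integral_cong) (auto simp: compose_def)
  with 1 have 1: "(LINT w|unit_lebesgue. \<bar>tau (f0 (\<phi> w)) - v (\<psi> w)\<bar>) \<le> \<eta> * e / 4" by simp
  obtain g where g: "g \<in> feats Y" and 2: "(LINT w|unit_lebesgue. \<bar>tau (g (\<psi> w)) - v (\<psi> w)\<bar>) < \<eta> * e / 4"
    using Y.K_tau_approx[OF \<psi> v, of "\<eta> * e / 4"] eta(1) e by auto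
  have lg: "Y.lipschitz g" using g by (rule Y.lipschitz_feats)
  \<comment> \<open>Two errors of \<eta>e/4: one from closeness of the sets \<open>K_tau\<close>,
    one from replacing \<open>v\<close> by tau of a feature. The total is what Markov's inequality
    at level \<eta> turns into e/2.\<close>
  have "(LINT w|unit_lebesgue. \<bar>tau (f0 (\<phi> w)) - tau (g (\<psi> w))\<bar>) \<le> \<eta> * (e/2)"
    using integral_tau_triangle[OF \<phi> \<psi> lip v lg 1 less_imp_le[OF 2]] by simp
  then have "measure unit_lebesgue {w\<in>{0..<1}. \<bar>f0 (\<phi> w) - g (\<psi> w)\<bar> > e} \<le> e"
    using S x by (intro tau_close_imp_prob_le[OF \<phi> \<psi> lip lg x _ R eta]) (auto simp: f0_def)
  then obtain g' where g': "g' \<in> feats Y"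
    and le: "measure unit_lebesgue {w\<in>{0..<1}. \<bar>(f0 (\<phi> w) + f x) - g' (\<psi> w)\<bar> > 2 * e} \<le> 2 * e"
    using ex_close_translated_feature[OF sat(2) \<phi> \<psi> lip lg e] by blast
  have "{w\<in>{0..<1}. \<bar>(f0 (\<phi> w) + f x) - g' (\<psi> w)\<bar> > 2 * e} = {w\<in>{0..<1}. \<bar>f (\<phi> w) - g' (\<psi> w)\<bar> > 2 * e}"
    using X.parameter_in_pts[OF \<phi>] by (auto simp: f0_def)
  with le g' show ?thesis by auto
qed

text \<open>Features on the varying space have no common base point. They are centred at a median instead,
  which forces their partners on the fixed space to be of moderate size at the base point.\<close>

lemma feats_half_close_to_base:
  assumes sat: "lip_saturated X" "lip_saturated Y"
    and \<phi>: "\<phi> \<in> parameters (gmeas X)" and \<psi>: "\<psi> \<in> parameters (gmeas Y)"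
    and e: "0 < e" "e \<le> 1/4"
    and x: "x \<in> pts X"
    and R: "X.prob (X.mball x R) \<ge> 1 - e/2"
    and eta: "\<eta> > 0" "\<forall>a b. \<bar>a\<bar> \<le> (R + 2) + R \<longrightarrow> \<bar>tau a - tau b\<bar> \<le> \<eta> \<longrightarrow> \<bar>a - b\<bar> \<le> e"
    and eta2: "\<eta> \<le> tau 2 - tau 1"
    and H: "\<forall>v\<in>K_tau Y. \<exists>u\<in>K_tau X. (LINT w|unit_lebesgue. \<bar>u (\<phi> w) - v (\<psi> w)\<bar>) < \<eta> * e / 4"
    and g: "g \<in> feats Y"
  shows "\<exists>f\<in>feats X. measure unit_lebesgue {w\<in>{0..<1}. \<bar>f (\<phi> w) - g (\<psi> w)\<bar> > 2 * e} \<le> 2 * e"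
proof -
  have [measurable]: "(\<lambda>w. g (\<psi> w)) \<in> borel_measurable unit_lebesgue"
    using g \<psi> by (simp add: Y.lipschitz_parameter_measurable Y.lipschitz_feats)
  obtain m where m: "U.prob {w \<in> space unit_lebesgue. g (\<psi> w) \<le> m} \<ge> 1/2"
      "U.prob {w \<in> space unit_lebesgue. g (\<psi> w) > m - 1} \<ge> 1/2"
    using U.ex_almost_median[of "\<lambda>w. g (\<psi> w)"] by auto
  define g0 where "g0 = restrict (\<lambda>y. g y + - m) (pts Y)"
  have g0: "g0 (\<psi> w) = g (\<psi> w) - m" if "w \<in> {0..<1}" for w
    using Y.parameter_in_pts[OF \<psi> that] by (simp add: g0_def)
  have lip: "Y.lipschitz g0" unfolding g0_def using Y.lipschitz_feats[OF g] by (rule Y.lipschitz_add_const)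
  have "g0 \<in> powertop_real (pts Y) closure_of feats Y"
    using lip by (intro Y.lip_saturatedD[OF sat(2)]) (auto simp: g0_def)
  then obtain u where u: "u \<in> K_tau X"
    and 1: "(LINT w|unit_lebesgue. \<bar>u (\<phi> w) - compose (pts Y) tau g0 (\<psi> w)\<bar>) < \<eta> * e / 4"
    using H Y.tau_closure_in_K_tau by blast
  have "(LINT w|unit_lebesgue. \<bar>u (\<phi> w) - compose (pts Y) tau g0 (\<psi> w)\<bar>)
      = (LINT w|unit_lebesgue. \<bar>tau (g0 (\<psi> w)) - u (\<phi> w)\<bar>)"
    using Y.parameter_in_pts[OF \<psi>]
    by (intro Bochner_Integration.integral_cong) (auto simp: compose_def abs_minus_commute)
  with 1 have 1: "(LINT w|unit_lebesgue. \<bar>tau (g0 (\<psi> w)) - u (\<phi> w)\<bar>) \<le> \<eta> * e / 4" by simp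
  obtain f where f: "f \<in> feats X" and 2: "(LINT w|unit_lebesgue. \<bar>tau (f (\<phi> w)) - u (\<phi> w)\<bar>) < \<eta> * e / 4"
    using X.K_tau_approx[OF \<phi> u, of "\<eta> * e / 4"] eta(1) e by auto
  have lf: "X.lipschitz f" using f by (rule X.lipschitz_feats)
  have "(LINT w|unit_lebesgue. \<bar>tau (g0 (\<psi> w)) - tau (f (\<phi> w))\<bar>) \<le> \<eta> * (e/2)"
    using YX.integral_tau_triangle[OF \<psi> \<phi> lip u lf 1 less_imp_le[OF 2]] by simp
  then have L: "(LINT w|unit_lebesgue. \<bar>tau (f (\<phi> w)) - tau (g0 (\<psi> w))\<bar>) \<le> \<eta> * (e/2)"
    by (simp add: abs_minus_commute)
  note [measurable] = X.lipschitz_parameter_measurable[OF lf \<phi>] Y.lipschitz_parameter_measurable[OF lip \<psi>]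
  have ph: "\<phi> \<in> unit_lebesgue \<rightarrow>\<^sub>M gmeas X" using \<phi> by (simp add: parameters_def)
  define A where "A = {w\<in>space unit_lebesgue. \<phi> w \<in> X.mball x R}"
  define B where "B = {w\<in>space unit_lebesgue. \<bar>tau (f (\<phi> w)) - tau (g0 (\<psi> w))\<bar> \<ge> \<eta>}"
  have A: "A \<in> U.events" unfolding A_def using measurable_sets[OF ph X.mball_in_sets[of x R]]
    by (simp only: vimage_def Int_def mem_Collect_eq conj_commute)
  have B: "B \<in> U.events" unfolding B_def by measurable
  \<comment> \<open>Since e is at most 1/4, each exceptional set has mass at most e/2, hence at most
    1/8. The sum 7/8 + 7/8 + 1/2 exceeds 2, which forces the good sets to meet either median
    event.\<close>
  have pA: "U.prob A \<ge> 7/8"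
    using X.prob_parameter[OF \<phi>, of "X.mball x R"] R e by (simp add: A_def)
  have "U.prob B \<le> (LINT w|unit_lebesgue. \<bar>tau (f (\<phi> w)) - tau (g0 (\<psi> w))\<bar>) / \<eta>"
    unfolding B_def using eta(1) abs_tau_diff_le_1
    by (intro integral_Markov_inequality_measure[where A="{}"] U.integrable_const_bound[of _ 1]) auto
  also have "\<dots> \<le> e/2" using L eta(1) by (simp add: field_simps)
  finally have pB: "U.prob (space unit_lebesgue - B) \<ge> 7/8"
    using e B by (subst U.prob_compl) auto
  have close: "\<bar>f x - f (\<phi> w)\<bar> \<le> R" if "w \<in> A" for w
  proof -
    have "\<phi> w \<in> X.mball x R" using that by (simp only: A_def mem_Collect_eq)
    then have "\<bar>f x - f (\<phi> w)\<bar> \<le> feat_dist X x (\<phi> w)" "feat_dist X x (\<phi> w) < R"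
      using lf x unfolding X.lipschitz_def by auto
    then show ?thesis by linarith
  qed
  have "f x \<le> R + 2"
  proof -
    have C: "{w \<in> space unit_lebesgue. g (\<psi> w) \<le> m}\<in> U.events" by measurable
    have sum: "U.prob A + U.prob (space unit_lebesgue - B) + U.prob {w \<in> space unit_lebesgue. g (\<psi> w) \<le> m} > 2"
      using pA pB m by linarith
    obtain w where w: "w \<in> A" "w \<in> space unit_lebesgue - B" "w \<in> {w \<in> space unit_lebesgue. g (\<psi> w) \<le> m}"
      using U.ex_mem_Int3[OF A sets.compl_sets[OF B] C sum] by blast
    have "g0 (\<psi> w) \<le> 0" using w g0[of w] by simp
    then have "tau (g0 (\<psi> w)) \<le> 0" using tau_less_iff[of 0 "g0 (\<psi> w)"] by simp
    moreover have "\<bar>tau (f (\<phi> w)) - tau (g0 (\<psi> w))\<bar> < \<eta>" using w by (auto simp: B_def)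
    moreover have "tau 0 < tau 1" by (simp only: tau_less_iff)
    \<comment> \<open>Here \<eta> + tau 1 \<le> tau 2 is used: a nonpositive value of
      \<open>g0\<close> allows only values of \<open>f\<close> below 2 nearby, and the ball adds at
      most \<open>R\<close> on the way to \<open>x\<close>.\<close>
    ultimately have "tau (f (\<phi> w)) < tau 2" using eta2 tau_0 by linarith
    then show ?thesis using close[OF w(1)] by simp
  qed
  moreover have "f x \<ge> - (R + 2)"
  proof -
    have C: "{w \<in> space unit_lebesgue. g (\<psi> w) > m - 1}\<in> U.events" by measurable
    have sum: "U.prob A + U.prob (space unit_lebesgue - B) + U.prob {w \<in> space unit_lebesgue. g (\<psi> w) > m - 1} > 2"
      using pA pB m by linarith
    obtain w where w: "w \<in> A" "w \<in> space unit_lebesgue - B" "w \<in> {w \<in> space unit_lebesgue. g (\<psi> w) > m - 1}"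
      using U.ex_mem_Int3[OF A sets.compl_sets[OF B] C sum] by blast
    have "- 1 < g0 (\<psi> w)" using w g0[of w] by simp
    then have "tau (- 1) < tau (g0 (\<psi> w))" by simp
    moreover have "\<bar>tau (f (\<phi> w)) - tau (g0 (\<psi> w))\<bar> < \<eta>" using w by (auto simp: B_def)
    moreover have "tau (- 1) = - tau 1" "tau (- 2) = - tau 2" by (simp_all add: tau_def)
    \<comment> \<open>The almost median only guarantees \<open>g0\<close> above -1, so the bound on
      \<eta> is needed in full: - tau 1 - \<eta> is at least - tau 2.\<close>
    ultimately have "tau (- 2) < tau (f (\<phi> w))" using eta2 by linarith
    then show ?thesis using close[OF w(1)] by simp
  qed
  ultimately have fx: "\<bar>f x\<bar> \<le> R + 2" by linarith
  have "measure unit_lebesgue {w\<in>{0..<1}. \<bar>f (\<phi> w) - g0 (\<psi> w)\<bar> > e} \<le> e"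
    by (rule tau_close_imp_prob_le[OF \<phi> \<psi> lf lip x fx R eta L])
  then have "measure unit_lebesgue {w\<in>{0..<1}. \<bar>g0 (\<psi> w) - f (\<phi> w)\<bar> > e} \<le> e"
    by (simp only: abs_minus_commute)
  then obtain f' where f': "f' \<in> feats X"
    and le: "measure unit_lebesgue {w\<in>{0..<1}. \<bar>(g0 (\<psi> w) + m) - f' (\<phi> w)\<bar> > 2 * e} \<le> 2 * e"
    using YX.ex_close_translated_feature[OF sat(1) \<psi> \<phi> lip lf e(1)] e(2) by auto
  have "{w\<in>{0..<1}. \<bar>(g0 (\<psi> w) + m) - f' (\<phi> w)\<bar> > 2 * e} = {w\<in>{0..<1}. \<bar>f' (\<phi> w) - g (\<psi> w)\<bar> > 2 * e}"
    using g0 by (auto simp: abs_minus_commute)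
  with le f' show ?thesis by auto
qed

lemma conc_close_imp_tau_close:
  assumes "conc_close X Y e" "e > 0"
  shows "tau_close X Y (3 * e)"
proof -
  obtain \<phi> \<psi> where \<phi>: "\<phi> \<in> parameters (gmeas X)" and \<psi>: "\<psi> \<in> parameters (gmeas Y)"
    and 1: "\<forall>f\<in>feats X. \<exists>g\<in>feats Y. measure unit_lebesgue {w\<in>{0..<1}. \<bar>f (\<phi> w) - g (\<psi> w)\<bar> > e} \<le> e"
    and 2: "\<forall>g\<in>feats Y. \<exists>f\<in>feats X. measure unit_lebesgue {w\<in>{0..<1}. \<bar>f (\<phi> w) - g (\<psi> w)\<bar> > e} \<le> e"
    using assms by (auto simp: conc_close_def)
  have 2: "\<forall>g\<in>feats Y. \<exists>f\<in>feats X. measure unit_lebesgue {w\<in>{0..<1}. \<bar>g (\<psi> w) - f (\<phi> w)\<bar> > e} \<le> e"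
    using 2 by (simp only: abs_minus_commute)
  show ?thesis
    unfolding tau_close_def
    using \<phi> \<psi> K_tau_half_close[OF \<phi> \<psi> assms(2) 1] YX.K_tau_half_close[OF \<psi> \<phi> assms(2) 2]
    by (intro bexI[OF _ \<phi>] bexI[OF _ \<psi>]) (simp only: abs_minus_commute, blast)
qed

end

text \<open>The radius and \<eta> come from \<open>X\<close> alone, so one \<delta> serves all
  saturated \<open>Y\<close>. The two half estimates use the same pair of parameters.\<close>

lemma (in geom_data) tau_close_imp_conc_close:
  assumes sat: "lip_saturated X" and e: "0 < e" "e \<le> 1/4"
  shows "\<exists>\<delta>>0. \<forall>Y :: 'b gds. geometric_data_set Y \<longrightarrow> lip_saturated Y \<longrightarrow> tau_close X Y \<delta> \<longrightarrow> conc_close X Y (2 * e)"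
proof -
  obtain x where x: "x \<in> pts X" using pts_nonempty by blast
  obtain R where R: "R \<ge> 0" "prob (mball x R) \<ge> 1 - e/2"
    using ex_ball_prob_ge[OF x, of "e/2"] e by auto
  obtain \<eta>' where eta': "\<eta>' > 0" "\<forall>a b. \<bar>a\<bar> \<le> (R + 2) + R \<longrightarrow> \<bar>tau a - tau b\<bar> \<le> \<eta>' \<longrightarrow> \<bar>a - b\<bar> \<le> e"
    using tau_inverse_uniform[OF e(1), of "(R + 2) + R"] by blast
  \<comment> \<open>The first entry inverts tau on the range of normalised features, the second
    supports the median argument.\<close>
  define \<eta> where "\<eta> = min \<eta>' (tau 2 - tau 1)"
  have "tau 1 < tau 2" by (simp only: tau_less_iff)
  then have eta: "\<eta> > 0" "\<eta> \<le> tau 2 - tau 1"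
    "\<forall>a b. \<bar>a\<bar> \<le> (R + 2) + R \<longrightarrow> \<bar>tau a - tau b\<bar> \<le> \<eta> \<longrightarrow> \<bar>a - b\<bar> \<le> e"
    using eta' by (auto simp: \<eta>_def)
  have "conc_close X Y (2 * e)"
    if Y: "geometric_data_set Y" "lip_saturated Y" and close: "tau_close X Y (\<eta> * e / 4)" for Y :: "'b gds"
  proof -
    interpret XY: geom_data_pair X Y using Y by unfold_locales
    obtain \<phi> \<psi> where \<phi>: "\<phi> \<in> parameters (gmeas X)" and \<psi>: "\<psi> \<in> parameters (gmeas Y)"
      and 1: "\<forall>u\<in>K_tau X. \<exists>v\<in>K_tau Y. (LINT w|unit_lebesgue. \<bar>u (\<phi> w) - v (\<psi> w)\<bar>) < \<eta> * e / 4"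
      and 2: "\<forall>v\<in>K_tau Y. \<exists>u\<in>K_tau X. (LINT w|unit_lebesgue. \<bar>u (\<phi> w) - v (\<psi> w)\<bar>) < \<eta> * e / 4"
      using close unfolding tau_close_def by blast
    have "e \<le> 1" "0 \<le> R + 2" using e R by simp_all
    from XY.feats_half_close_from_base[OF sat Y(2) \<phi> \<psi> e(1) this(1) x this(2) R(2) eta(1,3) 1]
      XY.feats_half_close_to_base[OF sat Y(2) \<phi> \<psi> e x R(2) eta(1,3,2) 2]
    show ?thesis unfolding conc_close_def using \<phi> \<psi> by blast
  qed
  then show ?thesis using eta(1) e by (intro exI[of _ "\<eta> * e / 4"]) auto
qed

section \<open>Isomorphism classes of mm-spaces\<close>

text \<open>Matching closures of features determine equal suprema of differences, so \<phi> is an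
  isometry. Full support of the target makes its image dense, and completeness of the source makes
  the image closed; hence \<phi> is onto.\<close>

lemma gds_isomorphicE:
  assumes "geometric_data_set Z" "geometric_data_set X" "gds_isomorphic Z X"
  obtains \<phi> where "\<phi> ` pts Z = pts X"
    and "\<And>x y. x \<in> pts Z \<Longrightarrow> y \<in> pts Z \<Longrightarrow> feat_dist X (\<phi> x) (\<phi> y) = feat_dist Z x y"
    and "(\<lambda>f. compose (pts Z) f \<phi>) ` (powertop_real (pts X) closure_of feats X)
          = powertop_real (pts Z) closure_of feats Z"
proof -
  interpret Z: geom_data Z by unfold_locales fact
  interpret X: geom_data X by unfold_locales fact
  obtain \<phi> where \<phi>: "\<phi> \<in> gmeas Z \<rightarrow>\<^sub>M gmeas X" and d: "distr (gmeas Z) (gmeas X) \<phi> = gmeas X"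
    and cl: "(\<lambda>f. compose (pts Z) f \<phi>) ` (powertop_real (pts X) closure_of feats X)
          = powertop_real (pts Z) closure_of feats Z"
    using assms(3) unfolding gds_isomorphic_def by blast
  have \<phi>X: "\<phi> x \<in> pts X" if "x \<in> pts Z" for x
    using measurable_space[OF \<phi>, of x] that by simp
  have iso: "feat_dist X (\<phi> x) (\<phi> y) = feat_dist Z x y" if xy: "x \<in> pts Z" "y \<in> pts Z" for x y
  proof (rule antisym)
    have "\<bar>f (\<phi> x) - f (\<phi> y)\<bar> \<le> feat_dist Z x y" if f: "f \<in> feats X" for f
    proof -
      have "f \<in> powertop_real (pts X) closure_of feats X"
        using f closure_of_powertop_real_superset[OF X.feats_extensional] by blast
      then have "compose (pts Z) f \<phi> \<in> powertop_real (pts Z) closure_of feats Z"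
        using cl by blast
      from Z.lipschitz_closure_feats[OF this] show ?thesis
        using xy by (auto simp: Z.lipschitz_def compose_def)
    qed
    then show "feat_dist X (\<phi> x) (\<phi> y) \<le> feat_dist Z x y"
      using xy X.feats_nonempty by (simp add: feat_dist_def[of X] \<phi>X cSUP_least)
    have "\<bar>f x - f y\<bar> \<le> feat_dist X (\<phi> x) (\<phi> y)" if f: "f \<in> feats Z" for f
    proof -
      have "f \<in> powertop_real (pts Z) closure_of feats Z"
        using f closure_of_powertop_real_superset[OF Z.feats_extensional] by blast
      then obtain g where g: "g \<in> powertop_real (pts X) closure_of feats X" "f = compose (pts Z) g \<phi>"
        using cl by blast
      from X.lipschitz_closure_feats[OF g(1)] show ?thesis
        using xy \<phi>X by (auto simp: X.lipschitz_def compose_def g(2))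
    qed
    then show "feat_dist Z x y \<le> feat_dist X (\<phi> x) (\<phi> y)"
      using xy Z.feats_nonempty by (simp add: feat_dist_def[of Z] cSUP_least)
  qed
  have "pts X \<subseteq> \<phi> ` pts Z"
  proof
    fix x assume x: "x \<in> pts X"
    \<comment> \<open>A ball missing the image would have empty preimage, hence measure 0, against
      full support.\<close>
    have "\<exists>z. z \<in> pts Z \<and> feat_dist X x (\<phi> z) < 1 / real (Suc n)" for n
    proof (rule ccontr)
      assume n: "\<not> ?thesis"
      have "X.prob (X.mball x (1 / real (Suc n))) > 0"
      proof (rule X.measure_open_pos)
        have "x \<in> X.mball x (1 / real (Suc n))" using x by simp
        then show "X.mball x (1 / real (Suc n)) \<noteq> {}" by blast
      qed simp
      moreover have "X.prob (X.mball x (1 / real (Suc n)))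
          = Z.prob (\<phi> -` X.mball x (1 / real (Suc n)) \<inter> space (gmeas Z))"
        using measure_distr[OF \<phi> X.mball_in_sets] d by simp
      moreover have "\<phi> -` X.mball x (1 / real (Suc n)) \<inter> space (gmeas Z) = {}"
        using n by auto
      ultimately show False by simp
    qed
    then obtain z where z: "\<And>n. z n \<in> pts Z" "\<And>n. feat_dist X x (\<phi> (z n)) < 1 / real (Suc n)"
      by metis
    have small: "feat_dist X x (\<phi> (z n)) < e" if "n \<ge> N" "1 / real (Suc N) < e" for n N e
    proof -
      have "1 / real (Suc n) \<le> 1 / real (Suc N)" using that by (simp add: frac_le)
      then show ?thesis using z(2)[of n] that by linarith
    qed
    \<comment> \<open>The images converge to \<open>x\<close>; the isometry transfers the Cauchy
      property back to \<open>Z\<close>, where a limit exists.\<close>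
    have "Z.MCauchy z"
      unfolding Z.MCauchy_def
    proof (intro conjI allI impI)
      show "range z \<subseteq> pts Z" using z by auto
      fix e :: real assume "e > 0"
      then obtain N where N: "1 / real (Suc N) < e/2" using nat_approx_posE[of "e/2"] by auto
      have "feat_dist Z (z n) (z n') < e" if "N \<le> n" "N \<le> n'" for n n'
      proof -
        have "feat_dist X (\<phi> (z n)) (\<phi> (z n')) \<le> feat_dist X (\<phi> (z n)) x + feat_dist X x (\<phi> (z n'))"
          using x z \<phi>X by (intro X.triangle) auto
        then show ?thesis
          using small[OF that(1) N] small[OF that(2) N] iso[OF z(1) z(1), of n n'] X.commute[of x "\<phi> (z n)"]
          by linarith
      qed
      then show "\<exists>N. \<forall>n n'. N \<le> n \<longrightarrow> N \<le> n' \<longrightarrow> feat_dist Z (z n) (z n') < e" by blast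
    qed
    then obtain l where l: "limitin Z.mtopology z l sequentially"
      using Z.complete by (auto simp: Z.mcomplete_def)
    then have lZ: "l \<in> pts Z" by (simp add: Z.limit_metric_sequentially)
    have "feat_dist X x (\<phi> l) \<le> 0"
    proof (rule field_le_epsilon)
      fix e :: real assume e: "e > 0"
      obtain N1 where N1: "1 / real (Suc N1) < e/2" using nat_approx_posE[of "e/2"] e by auto
      obtain N2 where N2: "\<forall>n\<ge>N2. z n \<in> pts Z \<and> feat_dist Z (z n) l < e/2"
        using l e unfolding Z.limit_metric_sequentially by (meson half_gt_zero)
      let ?n = "max N1 N2"
      have "feat_dist X x (\<phi> l) \<le> feat_dist X x (\<phi> (z ?n)) + feat_dist X (\<phi> (z ?n)) (\<phi> l)"
        using x z lZ \<phi>X by (intro X.triangle) auto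
      then show "feat_dist X x (\<phi> l) \<le> 0 + e"
        using small[of N1 ?n, OF _ N1] N2[rule_format, of ?n] iso[OF z(1) lZ, of ?n] by simp
    qed
    then have "x = \<phi> l"
      using X.nonneg[of x "\<phi> l"] X.zero[OF x \<phi>X[OF lZ]] by simp
    then show "x \<in> \<phi> ` pts Z" using lZ by blast
  qed
  then have "\<phi> ` pts Z = pts X" using \<phi>X by auto
  with iso cl that show ?thesis by blast
qed

text \<open>Lipschitz functions move along the bijective isometry, by composition with \<phi> in one
  direction and with its inverse in the other, and \<phi> matches the closures of features.\<close>

lemma lip_saturated_iso_iff:
  assumes "geometric_data_set Z" "geometric_data_set X" "gds_isomorphic Z X"
  shows "lip_saturated Z \<longleftrightarrow> lip_saturated X"
proof
  interpret Z: geom_data Z by unfold_locales fact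
  interpret X: geom_data X by unfold_locales fact
  obtain \<phi> where surj: "\<phi> ` pts Z = pts X"
    and iso: "\<And>x y. x \<in> pts Z \<Longrightarrow> y \<in> pts Z \<Longrightarrow> feat_dist X (\<phi> x) (\<phi> y) = feat_dist Z x y"
    and cl: "(\<lambda>f. compose (pts Z) f \<phi>) ` (powertop_real (pts X) closure_of feats X)
          = powertop_real (pts Z) closure_of feats Z"
    using gds_isomorphicE[OF assms] by blast
  have \<phi>X: "\<phi> x \<in> pts X" if "x \<in> pts Z" for x using surj that by blast
  have ext: "f \<in> extensional (pts X)" if "f \<in> powertop_real (pts X) closure_of feats X" for f
    using that by (simp add: closure_of_powertop_real_iff[OF X.feats_extensional])
  show "lip_saturated X" if sat: "lip_saturated Z"
    unfolding lip_saturated_def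
  proof (intro ballI impI)
    fix f assume f: "f \<in> extensional (pts X)"
      and lip: "\<forall>x\<in>pts X. \<forall>y\<in>pts X. \<bar>f x - f y\<bar> \<le> feat_dist X x y"
    have "Z.lipschitz (compose (pts Z) f \<phi>)"
      unfolding Z.lipschitz_def
    proof (intro ballI)
      fix x y assume xy: "x \<in> pts Z" "y \<in> pts Z"
      then have "\<bar>f (\<phi> x) - f (\<phi> y)\<bar> \<le> feat_dist X (\<phi> x) (\<phi> y)" using lip \<phi>X by blast
      then show "\<bar>compose (pts Z) f \<phi> x - compose (pts Z) f \<phi> y\<bar> \<le> feat_dist Z x y"
        using xy by (simp add: compose_eq iso)
    qed
    then have "compose (pts Z) f \<phi> \<in> powertop_real (pts Z) closure_of feats Z"
      by (intro Z.lip_saturatedD[OF sat] compose_extensional)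
    then obtain g where g: "g \<in> powertop_real (pts X) closure_of feats X"
      and eq: "compose (pts Z) f \<phi> = compose (pts Z) g \<phi>"
      using cl by (metis (no_types, lifting) imageE)
    have "f = g"
    proof (rule extensionalityI[OF f ext[OF g]])
      fix x assume "x \<in> pts X"
      then obtain z where z: "z \<in> pts Z" "x = \<phi> z" using surj by blast
      then show "f x = g x" using fun_cong[OF eq, of z] by (simp add: compose_def)
    qed
    with g show "f \<in> powertop_real (pts X) closure_of feats X" by simp
  qed
  show "lip_saturated Z" if sat: "lip_saturated X"
    unfolding lip_saturated_def
  proof (intro ballI impI)
    fix f assume f: "f \<in> extensional (pts Z)"
      and lip: "\<forall>x\<in>pts Z. \<forall>y\<in>pts Z. \<bar>f x - f y\<bar> \<le> feat_dist Z x y"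
    define p where "p = inv_into (pts Z) \<phi>"
    have p: "p x \<in> pts Z" "\<phi> (p x) = x" if "x \<in> pts X" for x
      using that surj by (auto simp: p_def inv_into_into f_inv_into_f)
    \<comment> \<open>Injectivity comes from distances: both points have the same image under an
      isometry.\<close>
    have p\<phi>: "p (\<phi> z) = z" if "z \<in> pts Z" for z
    proof -
      have "feat_dist Z (p (\<phi> z)) z = feat_dist X (\<phi> (p (\<phi> z))) (\<phi> z)"
        using iso p(1)[OF \<phi>X] that by simp
      also have "\<dots> = 0" using p(2)[OF \<phi>X[OF that]] \<phi>X[OF that] by simp
      finally show ?thesis using Z.zero p(1)[OF \<phi>X] that by simp
    qed
    have "X.lipschitz (compose (pts X) f p)"
      unfolding X.lipschitz_def
    proof (intro ballI)
      fix x y assume xy: "x \<in> pts X" "y \<in> pts X"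
      then have "\<bar>f (p x) - f (p y)\<bar> \<le> feat_dist Z (p x) (p y)" using lip p by simp
      also have "\<dots> = feat_dist X x y" using iso[of "p x" "p y"] p xy by simp
      finally show "\<bar>compose (pts X) f p x - compose (pts X) f p y\<bar> \<le> feat_dist X x y"
        using xy by (simp add: compose_def)
    qed
    then have "compose (pts X) f p \<in> powertop_real (pts X) closure_of feats X"
      by (intro X.lip_saturatedD[OF sat] compose_extensional)
    then have "compose (pts Z) (compose (pts X) f p) \<phi> \<in> powertop_real (pts Z) closure_of feats Z"
      using cl by blast
    moreover have "compose (pts Z) (compose (pts X) f p) \<phi> = f"
      by (rule extensionalityI[OF compose_extensional f]) (simp add: compose_def \<phi>X p\<phi>)
    ultimately show "f \<in> powertop_real (pts Z) closure_of feats Z" by simp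
  qed
qed

lemma lip_saturated_gds_of_mm: "lip_saturated (gds_of_mm X)"
proof -
  have "f \<in> powertop_real (pts (gds_of_mm X)) closure_of feats (gds_of_mm X)"
    if "f \<in> extensional (mspace (mmet X))"
      "\<forall>x\<in>mspace (mmet X). \<forall>y\<in>mspace (mmet X). \<bar>f x - f y\<bar> \<le> feat_dist (gds_of_mm X) x y" for f
  proof -
    have "f \<in> Lip1 (mmet X)" using that by (simp add: Lip1_def feat_dist_gds_of_mm)
    moreover have "Lip1 (mmet X) \<subseteq> extensional (mspace (mmet X))" by (auto simp: Lip1_def)
    ultimately have "f \<in> powertop_real (mspace (mmet X)) closure_of Lip1 (mmet X)"
      using closure_of_powertop_real_superset by blast
    then show ?thesis by (simp add: gds_of_mm_def)
  qed
  then show ?thesis by (simp add: lip_saturated_def gds_of_mm_def)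
qed

text \<open>Both \<open>gds_of_mm M\<close> and \<open>X\<close> are related to one \<open>Z\<close>
  that generates the class, so saturation travels back to \<open>Z\<close> and then on to
  \<open>X\<close>. This explains the equivalence in \<open>lip_saturated_iso_iff\<close>.\<close>

lemma mm_class_representative:
  assumes "C \<in> mm_classes" "X \<in> C"
  shows "geometric_data_set X \<and> lip_saturated X"
proof -
  obtain Z where Z: "geometric_data_set Z" and C: "C = gds_iso_rel `` {Z}"
    using assms(1) by (auto simp: mm_classes_def gds_classes_def quotient_def)
  obtain M where M: "mm_space M" "gds_of_mm M \<in> C"
    using assms(1) by (auto simp: mm_classes_def)
  have "lip_saturated Z"
    using lip_saturated_iso_iff[of Z "gds_of_mm M"] M C lip_saturated_gds_of_mm
    by (auto simp: gds_iso_rel_def)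
  then show ?thesis
    using lip_saturated_iso_iff[of Z X] assms(2) C by (auto simp: gds_iso_rel_def)
qed

section \<open>From closeness to the distances, the topologies and convergence\<close>

lemma d_conc_small_imp_d_tau_small:
  assumes "geometric_data_set X" "geometric_data_set Y" "d_conc X Y < e"
  shows "d_tau X Y \<le> 3 * e"
proof -
  interpret geom_data_pair X Y using assms by unfold_locales
  have "e > 0" using d_conc_nonneg assms(3) by linarith
  then show ?thesis using d_tau_leI conc_close_imp_tau_close d_conc_lessD assms(3) by blast
qed

text \<open>Both argument orders are recorded because balls of the topology have the fixed space as
  first argument, while the convergence statement has it as second.\<close>

lemma d_tau_small_imp_d_conc_small:
  fixes X :: "'a gds"
  assumes X: "geometric_data_set X" "lip_saturated X" and \<epsilon>: "\<epsilon> > 0"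
  shows "\<exists>\<delta>>0. \<forall>Y :: 'b gds. geometric_data_set Y \<and> lip_saturated Y \<longrightarrow>
    (d_tau X Y < \<delta> \<longrightarrow> d_conc X Y < \<epsilon>) \<and> (d_tau Y X < \<delta> \<longrightarrow> d_conc Y X < \<epsilon>)"
proof -
  interpret X: geom_data X using X by unfold_locales
  \<comment> \<open>The cap 1/4 is required by the median argument; \<epsilon>/4 makes the resulting
    bound 2e strictly smaller than \<epsilon>.\<close>
  define e where "e = min (\<epsilon>/4) (1/4)"
  have e: "0 < e" "e \<le> 1/4" "2 * e < \<epsilon>" using \<epsilon> by (auto simp: e_def)
  obtain \<delta> where \<delta>: "\<delta> > 0" "\<And>Y :: 'b gds. geometric_data_set Y \<Longrightarrow> lip_saturated Y \<Longrightarrow>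
      tau_close X Y \<delta> \<Longrightarrow> conc_close X Y (2 * e)"
    using X.tau_close_imp_conc_close[OF X(2) e(1,2)] by blast
  have "(d_tau X Y < \<delta> \<longrightarrow> d_conc X Y < \<epsilon>) \<and> (d_tau Y X < \<delta> \<longrightarrow> d_conc Y X < \<epsilon>)"
    if Y: "geometric_data_set Y" "lip_saturated Y" for Y :: "'b gds"
  proof -
    interpret geom_data_pair X Y using Y by unfold_locales
    have "d_conc X Y \<le> 2 * e" if "d_tau X Y < \<delta>"
      using d_tau_lessD[OF that] \<delta>(2)[OF Y] e by (intro d_conc_leI) auto
    moreover have "d_conc Y X \<le> 2 * e" if "d_tau Y X < \<delta>"
      using YX.d_conc_leI[OF conc_close_sym[OF \<delta>(2)[OF Y tau_close_sym[OF YX.d_tau_lessD[OF that]]]]] e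
      by simp
    ultimately show ?thesis using e(3) by fastforce
  qed
  with \<delta>(1) show ?thesis by blast
qed

theorem theorem3p9:
  "dist_topology (mm_classes :: 'a gds set set) (class_dist d_tau)
     = dist_topology mm_classes (class_dist d_conc) \<and>
   (\<forall>(X :: 'a mm) (Xs :: nat \<Rightarrow> 'a mm).
      mm_space X \<and> (\<forall>n. mm_space (Xs n)) \<longrightarrow>
      ((\<lambda>n. d_tau (gds_of_mm (Xs n)) (gds_of_mm X)) \<longlonglongrightarrow> 0 \<longleftrightarrow>
       (\<lambda>n. d_conc (gds_of_mm (Xs n)) (gds_of_mm X)) \<longlonglongrightarrow> 0))"
proof (intro conjI allI impI)
  have rep: "geometric_data_set (SOME X. X \<in> C) \<and> lip_saturated (SOME X. X \<in> C)"
    if "C \<in> (mm_classes :: 'a gds set set)" for C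
  proof -
    have "\<exists>X. X \<in> C" using that by (auto simp: mm_classes_def)
    then show ?thesis by (rule mm_class_representative[OF that someI_ex])
  qed
  \<comment> \<open>Nested balls with the same centre suffice for comparing the topologies, so the
    radius may depend on \<open>C\<close>.\<close>
  have tau_conc: "\<exists>s>0. {D \<in> mm_classes. class_dist d_tau C D < s} \<subseteq> {D \<in> mm_classes. class_dist d_conc C D < r}"
    if C: "C \<in> (mm_classes :: 'a gds set set)" and r: "r > 0" for C r
  proof -
    obtain \<delta> where "\<delta> > 0" "\<And>Y :: 'a gds. geometric_data_set Y \<Longrightarrow> lip_saturated Y \<Longrightarrow>
        d_tau (SOME X. X \<in> C) Y < \<delta> \<Longrightarrow> d_conc (SOME X. X \<in> C) Y < r"
      using d_tau_small_imp_d_conc_small[OF conjunct1[OF rep[OF C]] conjunct2[OF rep[OF C]] r] by blast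
    then show ?thesis using rep by (intro exI[of _ \<delta>]) (auto simp: class_dist_def)
  qed
  have conc_tau: "\<exists>s>0. {D \<in> mm_classes. class_dist d_conc C D < s} \<subseteq> {D \<in> mm_classes. class_dist d_tau C D < r}"
    if C: "C \<in> (mm_classes :: 'a gds set set)" and r: "r > 0" for C r
  proof -
    \<comment> \<open>Radius r/4, because the factor 3 still leaves 3r/4 below r.\<close>
    have "class_dist d_tau C D < r" if "D \<in> mm_classes" "class_dist d_conc C D < r/4" for D
      using d_conc_small_imp_d_tau_small[OF conjunct1[OF rep[OF C]] conjunct1[OF rep[OF that(1)]], of "r/4"]
        that r by (simp add: class_dist_def)
    then show ?thesis using r by (intro exI[of _ "r/4"]) auto
  qed
  show "dist_topology (mm_classes :: 'a gds set set) (class_dist d_tau)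
     = dist_topology mm_classes (class_dist d_conc)"
    unfolding topology_eq openin_dist_topology
  proof (intro allI conj_cong refl ball_cong iffI)
    fix S :: "'a gds set set" and C
    assume C: "S \<subseteq> mm_classes" "C \<in> S"
    show "\<exists>r>0. {D \<in> mm_classes. class_dist d_conc C D < r} \<subseteq> S"
      if ball: "\<exists>r>0. {D \<in> mm_classes. class_dist d_tau C D < r} \<subseteq> S"
    proof -
      obtain r where r: "r > 0" "{D \<in> mm_classes. class_dist d_tau C D < r} \<subseteq> S" using ball by blast
      obtain s where "s > 0" "{D \<in> mm_classes. class_dist d_conc C D < s} \<subseteq> {D \<in> mm_classes. class_dist d_tau C D < r}"
        using conc_tau[OF subsetD[OF C] r(1)] by blast
      with r(2) show ?thesis by (intro exI[of _ s] conjI subset_trans[OF _ r(2)])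
    qed
    show "\<exists>r>0. {D \<in> mm_classes. class_dist d_tau C D < r} \<subseteq> S"
      if ball: "\<exists>r>0. {D \<in> mm_classes. class_dist d_conc C D < r} \<subseteq> S"
    proof -
      obtain r where r: "r > 0" "{D \<in> mm_classes. class_dist d_conc C D < r} \<subseteq> S" using ball by blast
      obtain s where "s > 0" "{D \<in> mm_classes. class_dist d_tau C D < s} \<subseteq> {D \<in> mm_classes. class_dist d_conc C D < r}"
        using tau_conc[OF subsetD[OF C] r(1)] by blast
      with r(2) show ?thesis by (intro exI[of _ s] conjI subset_trans[OF _ r(2)])
    qed
  qed
next
  fix X :: "'a mm" and Xs :: "nat \<Rightarrow> 'a mm"
  assume mm: "mm_space X \<and> (\<forall>n. mm_space (Xs n))"
  have gds: "geometric_data_set (gds_of_mm X)" "\<And>n. geometric_data_set (gds_of_mm (Xs n))"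
    using mm geometric_data_set_gds_of_mm by auto
  have pair: "geom_data_pair (gds_of_mm (Xs n)) (gds_of_mm X)" for n
    using gds by (simp add: geom_data_pair_def geom_data_def)
  \<comment> \<open>Nonnegativity of the distances reduces convergence to upper bounds, the only
    form in which the comparison lemmas speak.\<close>
  have tendsto_iff: "a \<longlonglongrightarrow> 0 \<longleftrightarrow> (\<forall>r>0. eventually (\<lambda>n. a n < r) sequentially)"
    if "\<And>n. 0 \<le> a n" for a :: "nat \<Rightarrow> real"
    using that by (simp add: tendsto_iff dist_real_def)
  show "(\<lambda>n. d_tau (gds_of_mm (Xs n)) (gds_of_mm X)) \<longlonglongrightarrow> 0 \<longleftrightarrow>
       (\<lambda>n. d_conc (gds_of_mm (Xs n)) (gds_of_mm X)) \<longlonglongrightarrow> 0"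
    unfolding tendsto_iff[OF geom_data_pair.d_tau_nonneg[OF pair]]
      tendsto_iff[OF geom_data_pair.d_conc_nonneg[OF pair]]
  proof (intro iffI allI impI)
    fix r :: real assume r: "r > 0"
      and H: "\<forall>r>0. \<forall>\<^sub>F n in sequentially. d_tau (gds_of_mm (Xs n)) (gds_of_mm X) < r"
    obtain \<delta> where \<delta>: "\<delta> > 0" "\<And>Y :: 'a gds. geometric_data_set Y \<Longrightarrow> lip_saturated Y \<Longrightarrow>
        d_tau Y (gds_of_mm X) < \<delta> \<Longrightarrow> d_conc Y (gds_of_mm X) < r"
      using d_tau_small_imp_d_conc_small[OF gds(1) lip_saturated_gds_of_mm r] by blast
    from H \<delta>(1) have "\<forall>\<^sub>F n in sequentially. d_tau (gds_of_mm (Xs n)) (gds_of_mm X) < \<delta>" by blast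
    then show "\<forall>\<^sub>F n in sequentially. d_conc (gds_of_mm (Xs n)) (gds_of_mm X) < r"
      by eventually_elim (rule \<delta>(2)[OF gds(2) lip_saturated_gds_of_mm])
  next
    fix r :: real assume r: "r > 0"
      and H: "\<forall>r>0. \<forall>\<^sub>F n in sequentially. d_conc (gds_of_mm (Xs n)) (gds_of_mm X) < r"
    have "\<forall>\<^sub>F n in sequentially. d_conc (gds_of_mm (Xs n)) (gds_of_mm X) < r/4"
      using H[rule_format, of "r/4"] r by simp
    then show "\<forall>\<^sub>F n in sequentially. d_tau (gds_of_mm (Xs n)) (gds_of_mm X) < r"
    proof eventually_elim
      case (elim n)
      then show ?case using d_conc_small_imp_d_tau_small[OF gds(2) gds(1)] r by fastforce
    qed
  qed
qed

end
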